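(* For every positive integer $m$, the cyclotomic polytope $\mathcal{C}_m\subset\mathbb{R}^{\phi(m)}$ equals, up to a permutation of the coordinates, the $(m/\sqrt m)$-fold direct sum $\mathcal{C}_{\sqrt m}^{\circ (m/\sqrt m)}$, where $\sqrt m$ is the product of the distinct primes dividing $m$.
   Context: Cyclotomic polytopes are defined as follows. For $p$ prime, $\mathcal{C}_p=\operatorname{conv}(e_1,\dots,e_{p-1},-\sum_i e_i)\subset\mathbb{R}^{p-1}$. For $p$ prime and $\alpha\ge2$, with $\zeta=e^{2\pi i/p^\alpha}$, identify the $\mathbb{Z}$-basis element $\zeta^{k+jp^{\alpha-1}}$ ($0\le k\le p^{\alpha-1}-1$, $0\le j\le p-2$) of $\mathbb{Z}[\zeta]$ with the unit vector $e_{k(p-1)+j}\in\mathbb{R}^{\phi(p^\alpha)}$, and let $\mathcal{C}_{p^\alpha}$ be the convex hull of the points representing all $p^\alpha$ powers of $\zeta$. For $m=m_1m_2$ with $m_1,m_2>1$ coprime, use products of the chosen bases of $\mathbb{Z}[\zeta_{m_1}]$ and $\mathbb{Z}[\zeta_{m_2}]$ as a basis of $\mathbb{Z}[\zeta_m]$, identify $\mathbb{R}^{\phi(m)}=\mathbb{R}^{\phi(m_1)}\otimes\mathbb{R}^{\phi(m_2)}$ (Kronecker product coordinates), and set $\mathcal{C}_m=\mathcal{C}_{m_1}\otimes\mathcal{C}_{m_2}$, where for polytopes $P,Q$ with vertices $v_i$, $w_j$ the tensor product is $P\otimes Q=\operatorname{conv}(v_i\otimes w_j)$. Thus for $m=\prod_i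 p_i^{\alpha_i}$, $\mathcal{C}_m=\bigotimes_i\mathcal{C}_{p_i^{\alpha_i}}$, the convex hull of the points representing the $m$-th roots of unity. The direct sum of polytopes $P\subset\mathbb{R}^{d_1}$, $Q\subset\mathbb{R}^{d_2}$ containing the origin in their interiors is $P\circ Q=\operatorname{conv}(P\times\{0\}\cup\{0\}\times Q)$, and $P^{\circ k}$ is the $k$-fold direct sum. *)

theory Defs
  imports "HOL-Analysis.Analysis" "HOL-Analysis.Finite_Function_Topology"
    "HOL-Number_Theory.Number_Theory"
begin

text \<open>
  All dimensions below depend on \<open>m\<close>, so the space \<open>\<real>\<^sup>d\<close> is realised as the subspace of
  \<^typ>\<open>nat \<Rightarrow>\<^sub>0 real\<close> of the vectors supported on the coordinates \<open>0, \<dots>, d - 1\<close>.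
  The unit vector \<open>e\<^sub>i\<close> is \<open>Poly_Mapping.single i 1\<close>.
\<close>

type_synonym rvec = "nat \<Rightarrow>\<^sub>0 real"

abbreviation unit_vec :: "nat \<Rightarrow> rvec"
  where "unit_vec i \<equiv> Poly_Mapping.single i 1"

text \<open>
  Kronecker product of a vector \<open>v\<close> with a vector \<open>w\<close> of \<open>\<real>\<^sup>d\<close>:
  \<open>e\<^sub>i \<otimes> e\<^sub>j\<close> has index \<open>i * d + j\<close>.
\<close>
definition kronecker :: "nat \<Rightarrow> rvec \<Rightarrow> rvec \<Rightarrow> rvec"
  where "kronecker d v w =
    (\<Sum>i\<in>Poly_Mapping.keys v. \<Sum>j\<in>Poly_Mapping.keys w.
      Poly_Mapping.single (i * d + j) (Poly_Mapping.lookup v i * Poly_Mapping.lookup w j))"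

definition polytope_tensor :: "nat \<Rightarrow> rvec set \<Rightarrow> rvec set \<Rightarrow> rvec set"
  where "polytope_tensor d P Q =
    convex hull {kronecker d v w | v w. v extreme_point_of P \<and> w extreme_point_of Q}"

text \<open>The embedding \<open>x \<mapsto> (0, x)\<close> of \<open>\<real>\<^sup>n\<close> into \<open>\<real>\<^sup>d \<times> \<real>\<^sup>n = \<real>\<^sup>d\<^sup>+\<^sup>n\<close>.\<close>
definition shift_vec :: "nat \<Rightarrow> rvec \<Rightarrow> rvec"
  where "shift_vec d x =
    (\<Sum>i\<in>Poly_Mapping.keys x. Poly_Mapping.single (d + i) (Poly_Mapping.lookup x i))"

text \<open>
  Direct sum of \<open>P \<subseteq> \<real>\<^sup>d\<close> and \<open>Q\<close>. The embedding \<open>x \<mapsto> (x, 0)\<close> of the first factor is the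
  identity in this encoding.
\<close>
definition direct_sum :: "nat \<Rightarrow> rvec set \<Rightarrow> rvec set \<Rightarrow> rvec set"
  where "direct_sum d P Q = convex hull (P \<union> shift_vec d ` Q)"

text \<open>
  The \<open>k\<close>-fold direct sum of \<open>P \<subseteq> \<real>\<^sup>d\<close>. The recursion starts at \<open>k = 1\<close>, so that the 1-fold sum is
  \<open>P\<close> even if \<open>P\<close> does not contain the origin.
\<close>
fun direct_sum_power :: "nat \<Rightarrow> rvec set \<Rightarrow> nat \<Rightarrow> rvec set"
  where
    "direct_sum_power d P 0 = {0}"
  | "direct_sum_power d P (Suc 0) = P"
  | "direct_sum_power d P (Suc (Suc k)) =
       direct_sum (Suc k * d) (direct_sum_power d P (Suc k)) P"

text \<open>
  The integer vector \<open>x \<in> \<real>\<^bsup>\<phi>(p\<^sup>a)\<^esup>\<close> represents \<open>z \<in> \<int>[\<zeta>]\<close>, where \<open>\<zeta> = e\<^bsup>2\<pi>i/p\<^sup>a\<^esup>\<close>, in the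
  \<open>\<int>\<close>-basis whose element of index \<open>k (p - 1) + j\<close> is \<open>\<zeta>\<^bsup>k + j p\<^sup>a\<^sup>-\<^sup>1\<^esup>\<close>.
\<close>
definition represents :: "nat \<Rightarrow> nat \<Rightarrow> rvec \<Rightarrow> complex \<Rightarrow> bool"
  where "represents p a x z \<longleftrightarrow>
    Poly_Mapping.keys x \<subseteq> {..<totient (p ^ a)} \<and>
    (\<forall>i. Poly_Mapping.lookup x i \<in> \<int>) \<and>
    z = (\<Sum>k<p ^ (a - 1). \<Sum>j<p - 1.
          of_real (Poly_Mapping.lookup x (k * (p - 1) + j)) *
          exp (2 * of_real pi * \<i> / of_nat (p ^ a)) ^ (k + j * p ^ (a - 1)))"

text \<open>
  \<open>cyclotomic_polytope m P\<close>: \<open>P \<subseteq> \<real>\<^bsup>\<phi>(m)\<^esup>\<close> is a cyclotomic polytope of order \<open>m\<close>. This is a relation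
  because the Kronecker coordinates depend on the chosen factorisation of \<open>m\<close> and on the order of
  its factors. For \<open>m = 1\<close> it is the empty tensor product, the point \<open>1 \<in> \<real>\<^sup>1\<close>.
\<close>
inductive cyclotomic_polytope :: "nat \<Rightarrow> rvec set \<Rightarrow> bool"
  where
    one: "cyclotomic_polytope 1 {unit_vec 0}"
  | prime: "prime p \<Longrightarrow>
      cyclotomic_polytope p
        (convex hull (insert (- (\<Sum>i<p - 1. unit_vec i)) (unit_vec ` {..<p - 1})))"
  | prime_power: "prime p \<Longrightarrow> a \<ge> 2 \<Longrightarrow>
      cyclotomic_polytope (p ^ a)
        (convex hull {x. \<exists>n. represents p a x (exp (2 * of_real pi * \<i> / of_nat (p ^ a)) ^ n)})"
  | product: "m1 > 1 \<Longrightarrow> m2 > 1 \<Longrightarrow> coprime m1 m2 \<Longrightarrow>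
      cyclotomic_polytope m1 P \<Longrightarrow> cyclotomic_polytope m2 Q \<Longrightarrow>
      cyclotomic_polytope (m1 * m2) (polytope_tensor (totient m2) P Q)"

lemma cyclotomic_polytope_exists:
  assumes "m > 0"
  shows "\<exists>P. cyclotomic_polytope m P"
  using assms
proof (induction m rule: less_induct)
  case (less m)
  show ?case
  proof (cases "m = 1")
    case True
    then show ?thesis using cyclotomic_polytope.one by auto
  next
    case False
    then obtain p where p: "prime p" "p dvd m"
      using prime_factor_nat by blast
    obtain m' where m': "m = p ^ multiplicity p m * m'" "\<not> p dvd m'"
      using multiplicity_decompose'[of m p] less.prems p(1) prime_gt_1_nat[OF p(1)] by auto
    define a where "a = multiplicity p m"
    have a: "a \<ge> 1"
      using p(2) m' unfolding a_def by (cases "multiplicity p m") auto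
    have pa: "\<exists>P. cyclotomic_polytope (p ^ a) P"
    proof (cases "a = 1")
      case True
      then show ?thesis using cyclotomic_polytope.prime[OF p(1)] by auto
    next
      case False
      with a have "a \<ge> 2" by simp
      then show ?thesis using cyclotomic_polytope.prime_power[OF p(1)] by blast
    qed
    have pa1: "p ^ a > 1"
      using a p(1) prime_gt_1_nat[of p] by (intro one_less_power) auto
    show ?thesis
    proof (cases "m' = 1")
      case True
      then show ?thesis using pa m'(1) by (simp add: a_def)
    next
      case False
      have "m' > 0" using less.prems m'(1) by (cases "m' = 0") auto
      then have "m' > 1" using False by simp
      moreover have "m' < m"
        using pa1 \<open>m' > 0\<close> m'(1) unfolding a_def[symmetric] by simp
      moreover have "coprime (p ^ a) m'"
        using p(1) m'(2) by (simp add: prime_imp_coprime)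
      ultimately show ?thesis
        using pa less.IH[of m'] \<open>m' > 0\<close> pa1 m'(1) cyclotomic_polytope.product
        unfolding a_def[symmetric] by metis
    qed
  qed
qed

definition rad :: "nat \<Rightarrow> nat"
  where "rad m = \<Prod>(prime_factors m)"

text \<open>The vector with \<open>i\<close>-th coordinate \<open>x (\<sigma> i)\<close>, for a permutation \<open>\<sigma>\<close>.\<close>
abbreviation permute_coords :: "(nat \<Rightarrow> nat) \<Rightarrow> rvec \<Rightarrow> rvec"
  where "permute_coords \<sigma> x \<equiv> Poly_Mapping.map_key \<sigma> x"

end

theory Submission
  imports Defs
begin

text \<open>
  A coordinate of a cyclotomic polytope of order \<open>m\<close> is determined by a block number
  \<open>\<kappa> i < m / \<surd>m\<close> and, for every prime \<open>p\<close> dividing \<open>m\<close>, a residue \<open>\<iota> i p < p - 1\<close>. In this labelling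
  a vertex lives in a single block, where it is a product over the primes of vertices of
  the simplices \<open>\<C>\<^sub>p\<close>. This description is the same for all factorisations of \<open>m\<close>, it is preserved by
  the Kronecker product, and its block structure is the direct sum decomposition.

  Two points need arithmetic. For prime powers, a vector representing a given root of unity is
  unique because the cyclotomic polynomial is irreducible (Eisenstein). For products, all listed
  points are vertices because the evaluation map into the complex numbers sends them injectively to
  the unit circle.
\<close>

hide_const (open) up_ring.monom up_ring.coeff module.smult

section \<open>Cyclotomic polynomials of prime power order\<close>

text \<open>The inner binomial coefficients of \<open>p\<close> are divisible by \<open>p\<close>.
  The setting is a general commutative ring because the application is to polynomials.\<close>

lemma of_nat_prime_dvd_power_add:
  fixes x y :: "'a::comm_ring_1"
  assumes "prime p"
  shows "of_nat p dvd (x + y) ^ p - (x ^ p + y ^ p)"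
proof -
  have "(x + y) ^ p = (\<Sum>k\<le>p. of_nat (p choose k) * x ^ k * y ^ (p - k))"
    by (rule binomial_ring)
  also have "{..p} = insert 0 (insert p {0<..<p})"
    using prime_gt_0_nat[OF assms] by auto
  also have "(\<Sum>k\<in>\<dots>. of_nat (p choose k) * x ^ k * y ^ (p - k)) =
      x ^ p + y ^ p + (\<Sum>k\<in>{0<..<p}. of_nat (p choose k) * x ^ k * y ^ (p - k))"
    using prime_gt_0_nat[OF assms] by (subst sum.insert; simp)+
  finally have "(x + y) ^ p - (x ^ p + y ^ p) =
      (\<Sum>k\<in>{0<..<p}. of_nat (p choose k) * x ^ k * y ^ (p - k))"
    by simp
  also have "of_nat p dvd \<dots>"
  proof (rule dvd_sum)
    fix k assume "k \<in> {0<..<p}"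
    then have "p dvd (p choose k)"
      using assms by (intro dvd_choose_prime) auto
    then have "(of_nat p :: 'a) dvd of_nat (p choose k)"
      by (auto elim!: dvdE simp: of_nat_mult)
    then show "of_nat p dvd of_nat (p choose k) * x ^ k * y ^ (p - k)"
      by (metis dvd_mult2)
  qed
  finally show ?thesis .
qed

text \<open>Frobenius iterated: the congruence for \<open>k\<close> is raised to the power
  \<open>p\<close>, then the binomial congruence is applied to \<open>y + (-1)\<close>.\<close>

lemma of_nat_prime_dvd_diff_one_power:
  fixes x :: "'a::comm_ring_1"
  assumes "prime p"
  shows "of_nat p dvd (x - 1) ^ (p ^ k) - (x ^ (p ^ k) - 1)"
proof (induction k)
  case 0
  then show ?case by simp
next
  case (Suc k)
  define y where "y = x ^ (p ^ k)"
  have "(x - 1) ^ (p ^ k) - (y - 1) dvd ((x - 1) ^ (p ^ k)) ^ p - (y - 1) ^ p"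
    by (subst power_diff_sumr2[of _ p]) simp
  then have 1: "of_nat p dvd ((x - 1) ^ (p ^ k)) ^ p - (y - 1) ^ p"
    using Suc y_def dvd_trans by blast
  have 2: "of_nat p dvd (y - 1) ^ p - (y ^ p + (-1) ^ p)"
    using of_nat_prime_dvd_power_add[OF assms, of y "-1"] by simp
  \<comment> \<open>The sign matters only for \<open>p = 2\<close>, where the sum is 2 and hence
    divisible by \<open>p\<close>.\<close>
  have 3: "of_nat p dvd ((-1) ^ p + 1 :: 'a)"
  proof (cases "p = 2")
    case True
    then show ?thesis by simp
  next
    case False
    then have "odd p"
      using assms primes_dvd_imp_eq two_is_prime_nat by blast
    then show ?thesis by simp
  qed
  have "((x - 1) ^ (p ^ k)) ^ p - (y ^ p - 1) =
      (((x - 1) ^ (p ^ k)) ^ p - (y - 1) ^ p) + ((y - 1) ^ p - (y ^ p + (-1) ^ p)) + ((-1) ^ p + 1)"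
    by simp
  then have "of_nat p dvd ((x - 1) ^ (p ^ k)) ^ p - (y ^ p - 1)"
    using 1 2 3 by (metis dvd_add)
  then show ?case
    by (simp add: y_def mult.commute flip: power_mult)
qed

text \<open>For \<open>q = p\<^sup>b\<close>, this is the cyclotomic polynomial of order \<open>p q\<close>.\<close>
definition prime_power_cyclotomic :: "nat \<Rightarrow> nat \<Rightarrow> int poly"
  where "prime_power_cyclotomic p q = (\<Sum>j<p. monom 1 (j * q))"

lemma prime_power_cyclotomic_mult:
  "(monom 1 q - 1) * prime_power_cyclotomic p q = monom 1 (p * q) - 1"
proof -
  have "prime_power_cyclotomic p q = (\<Sum>j<p. monom 1 q ^ j)"
    by (simp add: prime_power_cyclotomic_def monom_power mult.commute)
  then show ?thesis
    using power_diff_1_eq[of "monom 1 q :: int poly" p] by (simp add: monom_power mult.commute)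
qed

text \<open>Modulo \<open>p\<close>, \<open>(X - 1)^q\<close> agrees with \<open>X^q - 1\<close>.
  Multiplying the difference by \<open>X^q - 1\<close> makes it visibly divisible by
  \<open>p\<close>; this factor cancels because \<open>p\<close> remains prime in
  \<open>int poly\<close>.\<close>

lemma prime_power_cyclotomic_cong:
  assumes p: "prime p" and q: "q = p ^ b"
  shows "[:int p:] dvd [:-1, 1:] ^ (q * (p - 1)) - prime_power_cyclotomic p q"
proof -
  let ?F = "prime_power_cyclotomic p q"
  let ?X = "monom 1 1 :: int poly"
  define Y where "Y = [:-1, 1::int:]"
  have Y: "Y = ?X - 1" by (simp add: Y_def monom_altdef one_pCons)
  have N: "[:int p:] = of_nat p" by (simp add: of_nat_poly)
  have q0: "q > 0" using q p by (simp add: prime_gt_0_nat)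
  have 1: "[:int p:] dvd Y ^ q - (monom 1 q - 1)"
    using of_nat_prime_dvd_diff_one_power[OF p, of ?X b] by (simp add: N Y q monom_power)
  have 2: "[:int p:] dvd Y ^ (q * p) - (monom 1 (p * q) - 1)"
    using of_nat_prime_dvd_diff_one_power[OF p, of ?X "Suc b"]
    by (simp add: N Y q monom_power mult.commute)
  have "q * p = q * (p - 1) + q"
    using prime_gt_0_nat[OF p] by (cases p) auto
  then have e: "Y ^ (q * p) = Y ^ (q * (p - 1)) * Y ^ q"
    by (simp add: power_add)
  have "(monom 1 q - 1) * (Y ^ (q * (p - 1)) - ?F) =
     (Y ^ (q * p) - (monom 1 (p * q) - 1)) - Y ^ (q * (p - 1)) * (Y ^ q - (monom 1 q - 1))"
    unfolding e prime_power_cyclotomic_mult[symmetric] by (simp add: algebra_simps)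
  then have "[:int p:] dvd (monom 1 q - 1) * (Y ^ (q * (p - 1)) - ?F)"
    using 1 2 by (metis dvd_diff dvd_mult)
  moreover have "prime_elem [:int p:]"
    using p by (simp add: prime_elem_const_poly_iff prime_imp_prime_elem)
  moreover have "\<not> [:int p:] dvd monom 1 q - 1"
  proof
    assume "[:int p:] dvd monom 1 q - 1"
    then have "int p dvd coeff (monom 1 q - 1) q" by (simp only: const_poly_dvd_iff)
    then have "int p dvd 1"
      using q0 by simp
    then show False using p by auto
  qed
  ultimately show ?thesis
    unfolding Y_def by (simp add: prime_elem_dvd_mult_iff)
qed

section \<open>Eisenstein's criterion over the integers\<close>

text \<open>If \<open>B\<close> had positive degree, induction on \<open>i\<close> would make
  \<open>p\<close> divide every coefficient of \<open>A\<close>: in coefficient \<open>i\<close> of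
  the product, only \<open>coeff A i * coeff B 0\<close> is not yet known to be divisible. This
  contradicts the leading coefficient.\<close>

lemma eisenstein_factor:
  fixes A B :: "int poly"
  assumes p: "prime p" and low: "\<And>i. i < degree (A * B) \<Longrightarrow> p dvd coeff (A * B) i"
    and lead: "\<not> p dvd lead_coeff (A * B)" and B0: "\<not> p dvd coeff B 0"
  shows "degree B = 0"
proof (rule ccontr)
  assume B: "degree B \<noteq> 0"
  have nz: "A \<noteq> 0" "B \<noteq> 0" using lead by auto
  then have deg: "degree (A * B) = degree A + degree B" by (simp add: degree_mult_eq)
  have "p dvd coeff A i" if "i \<le> degree A" for i
    using that
  proof (induction i rule: less_induct)
    case (less i)
    have "i < degree (A * B)" using less.prems deg B by simp
    then have "p dvd coeff (A * B) i" by (rule low)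
    moreover have "coeff (A * B) i = (\<Sum>j<i. coeff A j * coeff B (i - j)) + coeff A i * coeff B 0"
      by (simp add: coeff_mult lessThan_Suc_atMost[symmetric])
    moreover have "p dvd (\<Sum>j<i. coeff A j * coeff B (i - j))"
      by (intro dvd_sum dvd_mult2 less.IH) (use less.prems in auto)
    ultimately have "p dvd coeff A i * coeff B 0"
      by (simp add: dvd_add_right_iff)
    then show ?case using p B0 by (simp add: prime_dvd_mult_iff)
  qed
  then have "p dvd lead_coeff A * lead_coeff B" by simp
  then show False using lead deg by (simp add: coeff_mult_degree_sum)
qed

text \<open>As \<open>p^2\<close> does not divide the product of the constant coefficients,
  \<open>p\<close> misses one of them, and \<open>eisenstein_factor\<close> applies with that factor
  as \<open>B\<close>.\<close>

lemma eisenstein: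
  fixes A B :: "int poly"
  assumes p: "prime p" and low: "\<And>i. i < degree (A * B) \<Longrightarrow> p dvd coeff (A * B) i"
    and lead: "\<not> p dvd lead_coeff (A * B)" and sq: "\<not> p\<^sup>2 dvd coeff (A * B) 0"
  shows "degree A = 0 \<or> degree B = 0"
proof (cases "p dvd coeff B 0")
  case False
  then have "degree B = 0"
    using p low lead by (intro eisenstein_factor[of p A B]) auto
  then show ?thesis ..
next
  case True
  have "\<not> p dvd coeff A 0"
  proof
    assume "p dvd coeff A 0"
    with True have "p * p dvd coeff A 0 * coeff B 0" by (rule mult_dvd_mono[rotated])
    then show False using sq by (simp add: coeff_mult power2_eq_square)
  qed
  then show ?thesis
    using eisenstein_factor[of p B A] p low lead by (simp add: mult.commute)
qed

lemma pcompose_power: "(A ^ n) \<circ>\<^sub>p B = (A \<circ>\<^sub>p B) ^ n"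
  for A B :: "'a::comm_semiring_1 poly"
  by (induction n) (simp_all add: pcompose_1 pcompose_mult)

text \<open>The shift by 1 turns the congruence with \<open>(X - 1)^n\<close> into one with
  \<open>X^n\<close> for \<open>n = q * (p - 1)\<close>, which is the Eisenstein shape. The constant
  coefficient is the value at 1, a sum of \<open>p\<close> ones.\<close>

lemma prime_power_cyclotomic_shift:
  assumes p: "prime p" and q: "q = p ^ b"
  defines "G \<equiv> prime_power_cyclotomic p q \<circ>\<^sub>p [:1, 1:]"
  shows "degree G = q * (p - 1)" "\<And>i. i < q * (p - 1) \<Longrightarrow> int p dvd coeff G i"
    "\<not> int p dvd coeff G (q * (p - 1))" "coeff G 0 = int p"
proof -
  let ?n = "q * (p - 1)"
  have q0: "q > 0" using q p by (simp add: prime_gt_0_nat)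
  obtain H where H: "[:-1, 1:] ^ ?n - prime_power_cyclotomic p q = [:int p:] * H"
    using prime_power_cyclotomic_cong[OF p q] by (elim dvdE)
  have "([:-1, 1:] ^ ?n) \<circ>\<^sub>p [:1, 1:] = (monom 1 ?n :: int poly)"
    by (simp add: pcompose_power pcompose_pCons monom_altdef)
  then have HG: "monom 1 ?n - G = smult (int p) (H \<circ>\<^sub>p [:1, 1:])"
    using arg_cong[OF H, of "\<lambda>r. r \<circ>\<^sub>p [:1, 1:]"]
    by (simp add: G_def pcompose_diff pcompose_smult)
  then have G: "coeff G i = coeff (monom 1 ?n) i - int p * coeff (H \<circ>\<^sub>p [:1, 1:]) i" for i
    by (metis coeff_diff coeff_smult diff_eq_eq add_diff_cancel_left' add.commute)
  show "int p dvd coeff G i" if "i < ?n" for i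
    using that by (simp add: G)
  show nd: "\<not> int p dvd coeff G ?n"
  proof
    assume "int p dvd coeff G ?n"
    then have "int p dvd 1" by (simp add: G dvd_diff_left_iff)
    then show False using p by auto
  qed
  \<comment> \<open>The congruence alone would leave room for higher coefficients divisible by
    \<open>p\<close>, so the upper degree bound is read off the definition.\<close>
  have "degree (prime_power_cyclotomic p q) \<le> ?n"
    unfolding prime_power_cyclotomic_def
    by (intro degree_sum_le) (auto intro!: order.trans[OF degree_monom_le])
  then have "degree G \<le> ?n" by (simp add: G_def degree_pcompose)
  moreover have "coeff G ?n \<noteq> 0" using nd by auto
  ultimately show "degree G = ?n" by (simp add: le_degree order_antisym)
  show "coeff G 0 = int p"
    by (simp add: G_def pcompose_coeff_0 prime_power_cyclotomic_def poly_sum poly_monom)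
qed

text \<open>
  By pseudo-division and Gauss, a nonzero \<open>g\<close> of minimal degree vanishing at \<open>z\<close> would divide the
  polynomial.
\<close>
lemma prime_power_cyclotomic_minimal:
  fixes f :: "int poly" and z :: complex
  assumes p: "prime p" and q: "q = p ^ b"
    and z: "poly (map_poly of_int (prime_power_cyclotomic p q)) z = 0"
    and f: "poly (map_poly of_int f) z = 0" "degree f < q * (p - 1)"
  shows "f = 0"
proof (rule ccontr)
  assume f0: "f \<noteq> 0"
  let ?F = "prime_power_cyclotomic p q"
  define Z where "Z = (\<lambda>f::int poly. f \<noteq> 0 \<and> poly (map_poly of_int f) z = 0)"
  have "Z f" using f0 f by (simp add: Z_def)
  define g where "g = arg_min degree Z"
  have g: "Z g" "degree g \<le> degree f" "\<And>h. Z h \<Longrightarrow> degree g \<le> degree h"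
    using arg_min_nat_lemma[of Z f degree] \<open>Z f\<close> unfolding g_def by auto
  have g0: "g \<noteq> 0" using g by (simp add: Z_def)
  obtain a k where a: "a \<noteq> 0" and ak: "smult a ?F = g * k + pseudo_mod ?F g"
    using pseudo_mod(1)[OF g0, of ?F] by blast
  have mul: "map_poly of_int (u * v) = (map_poly of_int u * map_poly of_int v :: complex poly)"
    for u v :: "int poly" by (simp add: poly_eq_iff coeff_map_poly coeff_mult)
  have add: "map_poly of_int (u + v) = (map_poly of_int u + map_poly of_int v :: complex poly)"
    for u v :: "int poly" by (simp add: poly_eq_iff coeff_map_poly)
  have smult: "map_poly of_int (smult c u) = (smult (of_int c) (map_poly of_int u) :: complex poly)"
    for c and u :: "int poly" by (simp add: poly_eq_iff coeff_map_poly)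
  \<comment> \<open>Evaluation at \<open>z\<close> annihilates the remainder, so minimality of
    \<open>degree g\<close> forces it to be 0.\<close>
  have "poly (map_poly of_int (pseudo_mod ?F g)) z = 0"
    using arg_cong[OF ak, of "\<lambda>r. poly (map_poly of_int r) z"] z g(1)
    by (simp add: mul add smult Z_def)
  then have "pseudo_mod ?F g = 0"
    using g(3) pseudo_mod(2)[OF g0, of ?F] unfolding Z_def by (meson linorder_not_le)
  then have ak: "smult a ?F = g * k" using ak by simp
  have q0: "q > 0" using q p by (simp add: prime_gt_0_nat)
  have "content ?F dvd coeff ?F 0" by (rule content_dvd_coeff)
  also have "coeff ?F 0 = (\<Sum>j<p. if j = 0 then 1 else 0)"
    unfolding prime_power_cyclotomic_def coeff_sum using q0 by (intro sum.cong) auto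
  also have "\<dots> = 1" using p by (simp add: prime_gt_0_nat)
  finally have "content ?F = 1"
    by (metis is_unit_content_iff)
  then have cc: "\<bar>a\<bar> = content g * content k"
    using arg_cong[OF ak, of content] by (simp add: content_mult)
  \<comment> \<open>The contents absorb the absolute value of \<open>a\<close>; its sign is moved
    into one factor, which gives a factorisation over the integers.\<close>
  define A where "A = smult (sgn a) (primitive_part g)"
  define B where "B = primitive_part k"
  have "smult a ?F = smult \<bar>a\<bar> (primitive_part g * primitive_part k)"
    unfolding ak cc
    by (metis content_times_primitive_part mult_smult_left mult_smult_right smult_smult)
  also have "\<dots> = smult a (A * B)"
    by (simp add: A_def B_def abs_sgn mult.commute)
  finally have F: "?F = A * B"
    using a by (metis smult_cancel)
  have dA: "degree A = degree g"
    using a by (simp add: A_def sgn_eq_0_iff)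
  define A' B' where "A' = A \<circ>\<^sub>p [:1, 1:]" and "B' = B \<circ>\<^sub>p [:1, 1:]"
  have F': "?F \<circ>\<^sub>p [:1, 1:] = A' * B'"
    by (simp add: F A'_def B'_def pcompose_mult)
  note sh = prime_power_cyclotomic_shift[OF p q, unfolded F']
  have p1: "int p > 1" using prime_gt_1_nat[OF p] by simp
  have "\<not> (int p)\<^sup>2 dvd int p"
    using p1 by (auto dest!: zdvd_imp_le simp: power2_eq_square)
  then have "degree A' = 0 \<or> degree B' = 0"
    using p sh by (intro eisenstein[of "int p"]) auto
  moreover have "degree A' \<noteq> 0"
  proof
    assume "degree A' = 0"
    then have "degree g = 0" using dA by (simp add: A'_def degree_pcompose)
    then obtain c where "g = [:c:]" by (rule degree_eq_zeroE)
    then show False using g(1) by (simp add: Z_def map_poly_pCons)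
  qed
  \<comment> \<open>Otherwise \<open>A'\<close> has the full degree \<open>q * (p - 1)\<close>,
    whereas \<open>degree A = degree g\<close> is at most \<open>degree f\<close>.\<close>
  moreover have "degree B' \<noteq> 0"
  proof
    assume B: "degree B' = 0"
    have "A' * B' \<noteq> 0" using sh(4) p1 by auto
    then have "degree (A' * B') = degree A' + degree B'" by (intro degree_mult_eq) auto
    then show False using B sh(1) f(2) g(2) dA by (simp add: A'_def degree_pcompose)
  qed
  ultimately show False by blast
qed

section \<open>Cyclotomic polytopes of prime power order\<close>

definition vec_of :: "nat \<Rightarrow> (nat \<Rightarrow> real) \<Rightarrow> rvec"
  where "vec_of n g = (\<Sum>i<n. Poly_Mapping.single i (g i))"

lemma lookup_vec_of [simp]: "Poly_Mapping.lookup (vec_of n g) i = (if i < n then g i else 0)"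
  by (simp add: vec_of_def lookup_sum lookup_single when_def)

lemma keys_vec_of: "Poly_Mapping.keys (vec_of n g) \<subseteq> {..<n}"
  by (auto simp: in_keys_iff split: if_splits)

lemma vec_of_cong: "(\<And>i. i < n \<Longrightarrow> g i = h i) \<Longrightarrow> vec_of n g = vec_of n h"
  by (simp add: vec_of_def)

lemma rvec_eqI:
  assumes "Poly_Mapping.keys x \<subseteq> {..<n}" "Poly_Mapping.keys y \<subseteq> {..<n}" "\<And>i. i < n \<Longrightarrow> Poly_Mapping.lookup x i = Poly_Mapping.lookup y i"
  shows "x = (y :: rvec)"
  using assms by (intro poly_mapping_eqI) (metis in_keys_iff lessThan_iff subsetD)

lemma mixed_radix_less:
  fixes a b c d :: nat
  assumes "a < c" "b < d"
  shows "a * d + b < c * d"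
proof -
  have "a * d + b < Suc a * d" using assms by simp
  also have "\<dots> \<le> c * d" using assms by (intro mult_right_mono) auto
  finally show ?thesis .
qed

text \<open>Passes between flat coordinates and pairs of indices, both for
  \<open>k * (p - 1) + j\<close> in \<open>represents\<close> and for \<open>i * d + j\<close> in
  Kronecker products.\<close>

lemma sum_divmod:
  fixes g :: "nat \<Rightarrow> nat \<Rightarrow> 'a::comm_monoid_add"
  shows "(\<Sum>i<a * b. g (i div b) (i mod b)) = (\<Sum>k<a. \<Sum>j<b. g k j)"
proof (cases "b = 0")
  case False
  then show ?thesis
    unfolding sum.cartesian_product
    by (intro sum.reindex_bij_witness[of _ "\<lambda>(k, j). k * b + j" "\<lambda>i. (i div b, i mod b)"])
      (auto simp: less_mult_imp_div_less mixed_radix_less)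
qed simp

lemma primitive_root_power_inj:
  assumes "N > 0" "m < N" "n < N"
    and "exp (2 * of_real pi * \<i> / of_nat N) ^ m = exp (2 * of_real pi * \<i> / of_nat N) ^ n"
  shows "m = n"
proof -
  have "exp (2 * of_real pi * \<i> / of_nat N) ^ k = exp (2 * of_real pi * \<i> * of_nat k / of_nat N)" for k
    by (subst exp_of_nat_mult[symmetric]) (simp add: mult_ac)
  then show ?thesis
    using complex_root_unity_eq[of N m n] assms by (simp add: cong_def)
qed

lemma primitive_root_power:
  assumes "N > 0"
  shows "exp (2 * of_real pi * \<i> / of_nat N) ^ N = 1"
  using complex_root_unity[of N 1] assms by simp

text \<open>The \<open>j\<close>-th coordinate of the vertex of \<open>\<C>\<^sub>p\<close> that represents the \<open>t\<close>-th power of the root of unity.\<close>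
definition simplex_coord :: "nat \<Rightarrow> nat \<Rightarrow> nat \<Rightarrow> real"
  where "simplex_coord p t j = (if t = p - 1 then -1 else if j = t then 1 else 0)"

text \<open>The case \<open>a = 1\<close>, \<open>q = 1\<close> is included, so that primes and
  higher prime powers share one treatment.\<close>

locale prime_power_root =
  fixes p a q :: nat and \<zeta> :: complex
  assumes p: "prime p" and a: "a > 0"
    and q_def: "q = p ^ (a - 1)"
    and \<zeta>_def: "\<zeta> = exp (2 * of_real pi * \<i> / of_nat (p ^ a))"
begin

lemma q0: "q > 0" and p1: "p > 1" and pq: "p ^ a = p * q" and tot: "totient (p ^ a) = q * (p - 1)"
  using p a by (auto simp: q_def prime_gt_0_nat prime_gt_Suc_0_nat totient_prime_power simp flip: power_Suc)

lemma root_power: "\<zeta> ^ (p * q) = 1"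
  using primitive_root_power[of "p ^ a"] p1 q0 unfolding \<zeta>_def pq by simp

lemma root_power_inj: "m < p * q \<Longrightarrow> n < p * q \<Longrightarrow> \<zeta> ^ m = \<zeta> ^ n \<Longrightarrow> m = n"
  using primitive_root_power_inj[of "p ^ a" m n] p1 q0 unfolding \<zeta>_def pq by simp

lemma root_power_mod: "\<zeta> ^ (n mod (p * q)) = \<zeta> ^ n"
proof -
  have "\<zeta> ^ n = \<zeta> ^ (p * q * (n div (p * q)) + n mod (p * q))" by simp
  also have "\<dots> = \<zeta> ^ (n mod (p * q))"
    unfolding power_add power_mult[of \<zeta> "p * q"] root_power by simp
  finally show ?thesis ..
qed

text \<open>The geometric sum of \<open>\<zeta> ^ q\<close>, a \<open>p\<close>-th root of unity
  other than 1. This relation expresses the powers outside the basis.\<close>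

lemma root_sum: "(\<Sum>j<p. \<zeta> ^ (j * q)) = 0"
proof -
  have "\<zeta> ^ q \<noteq> 1"
    using root_power_inj[of q 0] q0 p1 by auto
  moreover have "(\<zeta> ^ q) ^ p = 1"
    using root_power by (simp add: mult.commute flip: power_mult)
  ultimately show ?thesis
    using power_diff_1_eq[of "\<zeta> ^ q" p] by (simp add: mult.commute flip: power_mult)
qed

text \<open>The basis element of index \<open>i\<close>: division by \<open>p - 1\<close> recovers
  \<open>k\<close> and \<open>j\<close> in the exponent \<open>k + j * q\<close>.\<close>

definition weight :: "nat \<Rightarrow> complex"
  where "weight i = \<zeta> ^ (i div (p - 1) + i mod (p - 1) * q)"

lemma represents_iff:
  "represents p a x z \<longleftrightarrow> Poly_Mapping.keys x \<subseteq> {..<q * (p - 1)} \<and> (\<forall>i. Poly_Mapping.lookup x i \<in> \<int>) \<and>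
     z = (\<Sum>i<q * (p - 1). of_real (Poly_Mapping.lookup x i) * weight i)"
proof -
  have "(\<Sum>i<q * (p - 1). of_real (Poly_Mapping.lookup x i) * weight i) =
      (\<Sum>i<q * (p - 1). of_real (Poly_Mapping.lookup x (i div (p - 1) * (p - 1) + i mod (p - 1))) *
         \<zeta> ^ (i div (p - 1) + i mod (p - 1) * q))"
    by (simp only: weight_def div_mult_mod_eq)
  also have "\<dots> = (\<Sum>k<q. \<Sum>j<p - 1. of_real (Poly_Mapping.lookup x (k * (p - 1) + j)) * \<zeta> ^ (k + j * q))"
    by (rule sum_divmod)
  finally show ?thesis
    by (simp add: represents_def tot q_def \<zeta>_def)
qed

text \<open>The coordinate differences are the coefficients of an integer polynomial of degree below
  \<open>q * (p - 1)\<close> that vanishes at \<zeta>, hence is 0 by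
  \<open>prime_power_cyclotomic_minimal\<close>.\<close>

lemma represents_unique:
  assumes "represents p a x z" "represents p a y z"
  shows "x = y"
proof -
  define n where "n = q * (p - 1)"
  have x: "Poly_Mapping.keys x \<subseteq> {..<n}" "\<And>i. Poly_Mapping.lookup x i \<in> \<int>"
    and y: "Poly_Mapping.keys y \<subseteq> {..<n}" "\<And>i. Poly_Mapping.lookup y i \<in> \<int>"
    using assms by (auto simp: represents_iff n_def)
  define c where "c i = \<lfloor>Poly_Mapping.lookup x i - Poly_Mapping.lookup y i\<rfloor>" for i
  have c: "Poly_Mapping.lookup x i - Poly_Mapping.lookup y i = of_int (c i)" for i
    using Ints_diff[OF x(2) y(2), of i i] by (simp add: c_def)
  \<comment> \<open>The exponent \<open>i = k + j * q\<close>, with \<open>k = i mod q\<close> and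
    \<open>j = i div q\<close>, belongs to the basis index \<open>k * (p - 1) + j\<close>.\<close>
  define f where "f = (\<Sum>i<n. monom (c (i mod q * (p - 1) + i div q)) i)"
  have f: "coeff f i = c (i mod q * (p - 1) + i div q)" if "i < n" for i
    using that by (simp add: f_def coeff_sum when_def)
  have "poly (map_poly of_int f) \<zeta> = (\<Sum>i<n. of_int (c (i mod q * (p - 1) + i div q)) * \<zeta> ^ i)"
  proof -
    have "map_poly of_int f = (\<Sum>i<n. monom (of_int (c (i mod q * (p - 1) + i div q))) i :: complex poly)"
      by (simp add: poly_eq_iff coeff_map_poly f_def coeff_sum of_int_sum if_distrib cong: if_cong)
    then show ?thesis by (simp add: poly_sum poly_monom)
  qed
  \<comment> \<open>The sum over exponents in base \<open>q\<close> is now transposed into a sum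
    over basis indices in base \<open>p - 1\<close>.\<close>
  also have "\<dots> = (\<Sum>i<(p - 1) * q. of_int (c (i mod q * (p - 1) + i div q)) * \<zeta> ^ (i div q * q + i mod q))"
    by (simp add: n_def mult.commute)
  also have "\<dots> = (\<Sum>j<p - 1. \<Sum>k<q. of_int (c (k * (p - 1) + j)) * \<zeta> ^ (j * q + k))"
    by (rule sum_divmod)
  also have "\<dots> = (\<Sum>k<q. \<Sum>j<p - 1. of_int (c (k * (p - 1) + j)) * \<zeta> ^ (k + j * q))"
    by (subst sum.swap) (simp add: add.commute)
  also have "\<dots> = (\<Sum>i<q * (p - 1). of_int (c (i div (p - 1) * (p - 1) + i mod (p - 1))) *
         \<zeta> ^ (i div (p - 1) + i mod (p - 1) * q))"
    by (rule sum_divmod[symmetric])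
  also have "\<dots> = (\<Sum>i<n. (of_real (Poly_Mapping.lookup x i) - of_real (Poly_Mapping.lookup y i)) * weight i)"
    unfolding n_def weight_def div_mult_mod_eq
    by (intro sum.cong) (simp_all flip: of_real_diff add: c)
  also have "\<dots> = 0"
    using assms by (simp add: represents_iff n_def left_diff_distrib sum_subtractf)
  finally have "poly (map_poly of_int f) \<zeta> = 0" .
  moreover have "poly (map_poly of_int (prime_power_cyclotomic p q)) \<zeta> = 0"
  proof -
    have "map_poly of_int (prime_power_cyclotomic p q) = (\<Sum>j<p. monom 1 (j * q) :: complex poly)"
      by (simp add: poly_eq_iff coeff_map_poly prime_power_cyclotomic_def coeff_sum of_int_sum
          if_distrib cong: if_cong)
    then show ?thesis using root_sum by (simp add: poly_sum poly_monom)
  qed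
  moreover have "degree f < n"
  proof -
    have "n > 0" using q0 p1 by (simp add: n_def)
    moreover have "degree f \<le> n - 1"
      unfolding f_def by (intro degree_sum_le) (auto intro!: order.trans[OF degree_monom_le])
    ultimately show ?thesis by simp
  qed
  ultimately have f0: "f = 0"
    using prime_power_cyclotomic_minimal[OF p q_def] by (simp add: n_def)
  show ?thesis
  proof (rule rvec_eqI[OF x(1) y(1)])
    fix i assume i: "i < n"
    define j k where "j = i mod (p - 1)" and "k = i div (p - 1)"
    have jk: "j < p - 1" "k < q"
      using i p1 by (auto simp: j_def k_def n_def less_mult_imp_div_less)
    have ijk: "i = k * (p - 1) + j" by (simp only: j_def k_def div_mult_mod_eq)
    have "k + j * q < n" using mixed_radix_less[OF jk] by (simp add: n_def ac_simps)
    then have "c i = 0"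
      using f[of "k + j * q"] jk q0 by (simp add: f0 ijk)
    then show "Poly_Mapping.lookup x i = Poly_Mapping.lookup y i" using c[of i] by simp
  qed
qed

definition point :: "nat \<Rightarrow> nat \<Rightarrow> rvec"
  where "point K t = vec_of (q * (p - 1))
    (\<lambda>i. if i div (p - 1) = K then simplex_coord p t (i mod (p - 1)) else 0)"

text \<open>Only block \<open>K\<close> contributes. For \<open>t < p - 1\<close> the root is a
  basis element; for \<open>t = p - 1\<close> it is minus the sum of the block by
  \<open>root_sum\<close>.\<close>

lemma point_represents:
  assumes K: "K < q" and t: "t < p"
  shows "represents p a (point K t) (\<zeta> ^ (K + t * q))"
proof -
  have Ints: "simplex_coord p t j \<in> \<int>" for j by (simp add: simplex_coord_def)
  have "(\<Sum>i<q * (p - 1). of_real (Poly_Mapping.lookup (point K t) i) * weight i) =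
      (\<Sum>i<q * (p - 1). (if i div (p - 1) = K then of_real (simplex_coord p t (i mod (p - 1))) else 0) *
         \<zeta> ^ (i div (p - 1) + i mod (p - 1) * q))"
    by (intro sum.cong) (simp_all add: point_def weight_def)
  also have "\<dots> = (\<Sum>k<q. \<Sum>j<p - 1. (if k = K then of_real (simplex_coord p t j) else 0) * \<zeta> ^ (k + j * q))"
    by (rule sum_divmod)
  also have "\<dots> = (\<Sum>k<q. if k = K then (\<Sum>j<p - 1. of_real (simplex_coord p t j) * \<zeta> ^ (K + j * q)) else 0)"
    by (intro sum.cong) auto
  also have "\<dots> = (\<Sum>j<p - 1. of_real (simplex_coord p t j) * \<zeta> ^ (K + j * q))"
    using K by simp
  also have "\<dots> = \<zeta> ^ (K + t * q)"
  proof (cases "t = p - 1")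
    case False
    then have "(\<Sum>j<p - 1. of_real (simplex_coord p t j) * \<zeta> ^ (K + j * q)) =
        (\<Sum>j<p - 1. if j = t then \<zeta> ^ (K + t * q) else 0)"
      by (intro sum.cong) (auto simp: simplex_coord_def)
    then show ?thesis using False t by simp
  next
    case True
    have "{..<p} = insert (p - 1) {..<p - 1}" using p1 by auto
    then have "(\<Sum>j<p - 1. \<zeta> ^ (j * q)) = - (\<zeta> ^ ((p - 1) * q))"
      using root_sum by (simp add: add_eq_0_iff2)
    then have "\<zeta> ^ K * (\<Sum>j<p - 1. \<zeta> ^ (j * q)) = - (\<zeta> ^ (K + t * q))"
      using True by (simp add: power_add)
    then show ?thesis using True
      by (simp add: simplex_coord_def sum_negf power_add sum_distrib_left)
  qed
  finally show ?thesis
    using Ints keys_vec_of by (auto simp: represents_iff point_def)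
qed

text \<open>An exponent reduced modulo \<open>p * q\<close> has the form \<open>K + t * q\<close>,
  and \<open>represents_unique\<close> leaves \<open>point K t\<close> as the only representing
  vector.\<close>

lemma represents_root_iff:
  "(\<exists>n. represents p a x (\<zeta> ^ n)) \<longleftrightarrow> (\<exists>K<q. \<exists>t<p. x = point K t)"
proof
  assume "\<exists>n. represents p a x (\<zeta> ^ n)"
  then obtain n where n: "represents p a x (\<zeta> ^ n)" by blast
  define r where "r = n mod (p * q)"
  have "r < p * q" using p1 q0 by (simp add: r_def)
  then have rt: "r mod q < q" "r div q < p"
    using q0 by (auto simp: less_mult_imp_div_less)
  have "represents p a (point (r mod q) (r div q)) (\<zeta> ^ n)"
    using point_represents[OF rt] root_power_mod[of n] by (simp add: r_def add.commute)
  then show "\<exists>K<q. \<exists>t<p. x = point K t"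
    using represents_unique[OF n] rt by blast
qed (use point_represents in blast)

end

section \<open>Linear maps, extreme points and direct sums\<close>

lemma lookup_scaleR: "Poly_Mapping.lookup (c *\<^sub>R x) i = c *\<^sub>R Poly_Mapping.lookup x i"
proof -
  have "finite {i. c *\<^sub>R Poly_Mapping.lookup x i \<noteq> 0}"
    by (rule finite_subset[OF _ finite_keys[of x]]) (auto simp: in_keys_iff)
  then show ?thesis by (simp add: scaleR_poly_mapping_def)
qed

lemma lookup_shift_vec:
  "Poly_Mapping.lookup (shift_vec d x) i = (if i < d then 0 else Poly_Mapping.lookup x (i - d))"
proof -
  \<comment> \<open>For \<open>i < d\<close> the natural number \<open>i - d\<close> is 0, hence the
    guard inside the summand.\<close>
  have "Poly_Mapping.lookup (shift_vec d x) i =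
      (\<Sum>j\<in>Poly_Mapping.keys x. if j = i - d then if i < d then 0 else Poly_Mapping.lookup x j else 0)"
    unfolding shift_vec_def lookup_sum
    by (intro sum.cong) (auto simp: lookup_single when_def)
  then show ?thesis by (auto simp: in_keys_iff)
qed

lemma shift_vec_0 [simp]: "shift_vec 0 x = x"
  by (intro poly_mapping_eqI) (simp add: lookup_shift_vec)

lemma linear_shift_vec: "linear (shift_vec d)"
  by (intro linearI poly_mapping_eqI) (simp_all add: lookup_shift_vec lookup_add lookup_scaleR)

lemma lookup_permute_coords:
  assumes "inj \<sigma>"
  shows "Poly_Mapping.lookup (permute_coords \<sigma> x) i = Poly_Mapping.lookup x (\<sigma> i)"
  by (simp add: map_key.rep_eq[OF assms])

lemma linear_permute_coords:
  assumes "inj \<sigma>"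
  shows "linear (permute_coords \<sigma> :: rvec \<Rightarrow> rvec)"
  by (intro linearI poly_mapping_eqI)
    (simp_all add: lookup_permute_coords[OF assms] lookup_add lookup_scaleR)

text \<open>The bound on the keys of \<open>w\<close> makes \<open>j\<close> a remainder modulo
  \<open>d\<close>, so at most one pair of indices contributes to coordinate
  \<open>n\<close>.\<close>

lemma lookup_kronecker:
  assumes "Poly_Mapping.keys w \<subseteq> {..<d}"
  shows "Poly_Mapping.lookup (kronecker d v w) n =
    Poly_Mapping.lookup v (n div d) * Poly_Mapping.lookup w (n mod d)"
proof -
  have eq: "i * d + j = n \<longleftrightarrow> i = n div d \<and> j = n mod d" if "j < d" for i j
  proof
    assume "i * d + j = n"
    with that show "i = n div d \<and> j = n mod d" by auto
  qed auto
  have "Poly_Mapping.lookup (kronecker d v w) n =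
      (\<Sum>i\<in>Poly_Mapping.keys v. \<Sum>j\<in>Poly_Mapping.keys w.
        if i = n div d then if j = n mod d then Poly_Mapping.lookup v i * Poly_Mapping.lookup w j else 0 else 0)"
    unfolding kronecker_def lookup_sum lookup_single when_def
    by (intro sum.cong refl) (use eq assms in auto)
  also have "\<dots> = (\<Sum>i\<in>Poly_Mapping.keys v. if i = n div d then
      Poly_Mapping.lookup v i * Poly_Mapping.lookup w (n mod d) else 0)"
    by (intro sum.cong refl) (auto simp: in_keys_iff)
  also have "\<dots> = Poly_Mapping.lookup v (n div d) * Poly_Mapping.lookup w (n mod d)"
    by (auto simp: in_keys_iff)
  finally show ?thesis .
qed

lemma kronecker_vec_of:
  "kronecker d (vec_of n g) (vec_of d h) = vec_of (n * d) (\<lambda>i. g (i div d) * h (i mod d))"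
proof (rule poly_mapping_eqI)
  fix i
  show "Poly_Mapping.lookup (kronecker d (vec_of n g) (vec_of d h)) i =
      Poly_Mapping.lookup (vec_of (n * d) (\<lambda>i. g (i div d) * h (i mod d))) i"
  proof (cases "d = 0")
    case False
    then have "i div d < n \<longleftrightarrow> i < n * d" by (simp add: div_less_iff_less_mult)
    then show ?thesis
      using False by (simp add: lookup_kronecker[OF keys_vec_of])
  qed (simp add: lookup_kronecker[OF keys_vec_of])
qed

section \<open>Extreme points and points of the unit circle\<close>

lemma weighted_sum_less:
  fixes a b s t :: real
  assumes "a > 0" "b > 0" "s \<le> 1" "t \<le> 1" "s < 1 \<or> t < 1"
  shows "a * s + b * t < a * 1 + b * 1"
  using assms by (elim disjE) (auto intro: add_less_le_mono add_le_less_mono)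

text \<open>The functional \<open>x \<mapsto> E v \<bullet> E x\<close> attains its maximum over \<open>V\<close> only at \<open>v\<close>.\<close>
lemma extreme_points_of_convex_hull_unimodular:
  fixes E :: "'a::real_vector \<Rightarrow> complex"
  assumes lin: "linear E" and norm: "\<And>v. v \<in> V \<Longrightarrow> norm (E v) = 1" and inj: "inj_on E V"
  shows "{x. x extreme_point_of (convex hull V)} = V"
proof (intro equalityI subsetI CollectI)
  show "x \<in> V" if "x \<in> {x. x extreme_point_of (convex hull V)}" for x
    using that extreme_point_of_convex_hull by blast
next
  fix v assume v: "v \<in> V"
  define f where "f x = E v \<bullet> E x" for x
  have f: "f (a *\<^sub>R x + b *\<^sub>R y) = a * f x + b * f y" for a b x y
    by (simp add: f_def linear_add[OF lin] linear_scale[OF lin] inner_right_distrib)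
  have fv: "f v = 1"
    using norm[OF v] by (simp add: f_def flip: power2_norm_eq_inner)
  have fV: "f u < 1" if u: "u \<in> V" "u \<noteq> v" for u
  proof -
    have "E v \<noteq> E u" using inj v u by (auto dest: inj_onD)
    \<comment> \<open>Distinct points of the unit circle have positive squared distance, which
      expands to \<open>2 - 2 * f u\<close>.\<close>
    then have "0 < (norm (E v - E u))\<^sup>2" by simp
    also have "\<dots> = 2 - 2 * f u"
      using norm[OF v] norm[OF u(1)]
      by (simp add: f_def power2_norm_eq_inner inner_diff_left inner_diff_right inner_commute norm_eq_1)
    finally show ?thesis by simp
  qed
  \<comment> \<open>An open half-plane condition with the one boundary point \<open>v\<close> added
    is still convex. So the hull lies in \<open>S\<close>, and a segment of the hull with
    \<open>v\<close> inside has both ends at \<open>v\<close>.\<close>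
  define S where "S = insert v {x. f x < 1}"
  have S: "f x \<le> 1" "f x = 1 \<Longrightarrow> x = v" if "x \<in> S" for x
    using that fv by (auto simp: S_def)
  have "convex S"
    unfolding convex_def
  proof (intro ballI allI impI)
    fix x y a b assume xy: "x \<in> S" "y \<in> S" and ab: "0 \<le> (a::real)" "0 \<le> b" "a + b = 1"
    consider "a = 0" | "b = 0" | "x = v" "y = v" | "a > 0" "b > 0" "f x < 1 \<or> f y < 1"
      using ab S[OF xy(1)] S[OF xy(2)] by force
    then show "a *\<^sub>R x + b *\<^sub>R y \<in> S"
    proof cases
      case 3
      then have "a *\<^sub>R x + b *\<^sub>R y = v" using ab by (simp flip: scaleR_add_left)
      then show ?thesis by (simp add: S_def)
    next
      case 4
      have "a * f x + b * f y < a * 1 + b * 1"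
        using 4 S(1)[OF xy(1)] S(1)[OF xy(2)]
        by (intro weighted_sum_less) auto
      then show ?thesis using ab by (simp add: S_def f)
    qed (use ab xy in auto)
  qed
  moreover have "V \<subseteq> S" using fV by (auto simp: S_def)
  ultimately have hull: "convex hull V \<subseteq> S" by (simp add: hull_minimal)
  show "v extreme_point_of (convex hull V)"
    unfolding extreme_point_of_def
  proof (intro conjI ballI notI)
    show "v \<in> convex hull V" using v by (rule hull_inc)
  next
    fix x y assume "x \<in> convex hull V" "y \<in> convex hull V" and seg: "v \<in> open_segment x y"
    then have xy: "x \<in> S" "y \<in> S" using hull by auto
    obtain u where u: "0 < u" "u < 1" "v = (1 - u) *\<^sub>R x + u *\<^sub>R y" and ne: "x \<noteq> y"
      using seg by (auto simp: in_segment)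
    have sum1: "(1 - u) * f x + u * f y = 1" using f[of "1 - u" x u y] u(3) fv by simp
    have "f x = 1 \<and> f y = 1"
    proof (rule ccontr)
      assume "\<not> (f x = 1 \<and> f y = 1)"
      then have "f x < 1 \<or> f y < 1" using S(1)[OF xy(1)] S(1)[OF xy(2)] by auto
      then have "(1 - u) * f x + u * f y < (1 - u) * 1 + u * 1"
        using u S(1)[OF xy(1)] S(1)[OF xy(2)]
        by (intro weighted_sum_less) auto
      then show False using sum1 by simp
    qed
    then show False using S(2)[OF xy(1)] S(2)[OF xy(2)] ne by simp
  qed
qed

text \<open>Linear shifts commute with hulls, and a hull of a union absorbs the hulls of its parts,
  so the nested hulls of the recursion collapse into one.\<close>

lemma direct_sum_power_convex_hull:
  assumes "k > 0"
  shows "direct_sum_power d (convex hull V) k = convex hull (\<Union>K<k. shift_vec (K * d) ` V)"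
  using assms
proof (induction k rule: nat_induct_non_zero)
  case 1
  show ?case by (simp add: lessThan_Suc)
next
  case (Suc k)
  obtain k' where k': "k = Suc k'" using Suc.hyps by (cases k) auto
  have "direct_sum_power d (convex hull V) (Suc k) =
      convex hull ((convex hull (\<Union>K<k. shift_vec (K * d) ` V)) \<union> (convex hull (shift_vec (k * d) ` V)))"
    using Suc.IH by (simp add: k' direct_sum_def convex_hull_linear_image[OF linear_shift_vec])
  also have "\<dots> = convex hull ((\<Union>K<k. shift_vec (K * d) ` V) \<union> shift_vec (k * d) ` V)"
    by (metis hull_Un_left hull_Un_right)
  finally show ?case by (simp add: lessThan_Suc Un_commute)
qed

section \<open>The product of the distinct prime factors\<close>

lemma prime_factors_rad: "prime_factors (rad m) = prime_factors m"
proof -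
  have "rad m \<noteq> 0" by (auto simp: rad_def)
  moreover have "prime p \<and> p dvd rad m \<longleftrightarrow> p \<in> prime_factors m" for p
    unfolding rad_def
    by (auto simp: prime_dvd_prod_iff in_prime_factors_iff intro: dvd_prodI) (metis dvd_trans)
  ultimately show ?thesis by (auto simp: prime_factors_dvd)
qed

lemma rad_rad [simp]: "rad (rad m) = rad m"
  by (simp add: rad_def[of "rad m"] prime_factors_rad) (simp add: rad_def)

lemma rad_pos: "rad m > 0"
  by (auto simp: rad_def intro!: prod_pos prime_gt_0_nat)

lemma rad_dvd:
  assumes "m > 0"
  shows "rad m dvd m"
proof -
  have "rad m dvd (\<Prod>p\<in>prime_factors m. p ^ multiplicity p m)"
    unfolding rad_def by (intro prod_dvd_prod) (auto simp: prime_factors_multiplicity)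
  then show ?thesis using assms by (metis prime_factorization_nat)
qed

lemma rad_mult:
  assumes "m > 0" "n > 0" "coprime m n"
  shows "rad (m * n) = rad m * rad n"
proof -
  have "prime_factors m \<inter> prime_factors n = {}"
    using assms(3) by (auto simp: in_prime_factors_iff) (metis coprime_common_divisor not_prime_unit)
  then show ?thesis
    using assms by (simp add: rad_def prime_factors_product prod.union_disjoint)
qed

text \<open>In Euler's product formula, \<open>totient m / m\<close> depends only on the set of
  primes, which \<open>m\<close> shares with \<open>rad m\<close>.\<close>

lemma totient_rad:
  assumes "m > 0"
  shows "totient m = m div rad m * totient (rad m)"
proof -
  have "real (totient m) = real (m div rad m * rad m) * (\<Prod>p\<in>prime_factors m. 1 - 1 / real p)"
    using rad_dvd[OF assms] by (simp add: totient_formula2)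
  also have "\<dots> = real (m div rad m) * real (totient (rad m))"
    by (simp add: totient_formula2[of "rad m"] prime_factors_rad)
  finally show ?thesis
    by (metis of_nat_eq_iff of_nat_mult)
qed

section \<open>The standard form of a cyclotomic polytope\<close>

text \<open>
  The functions \<open>\<kappa>\<close> and \<open>\<iota>\<close> label the coordinates below \<open>totient m\<close> bijectively; only the values of
  \<open>\<iota> i\<close> at the prime factors of \<open>m\<close> matter.
\<close>
definition labelling :: "nat \<Rightarrow> (nat \<Rightarrow> nat) \<Rightarrow> (nat \<Rightarrow> nat \<Rightarrow> nat) \<Rightarrow> bool"
  where "labelling m \<kappa> \<iota> \<longleftrightarrow>
    (\<forall>i<totient m. \<kappa> i < m div rad m \<and> (\<forall>p\<in>prime_factors m. \<iota> i p < p - 1)) \<and>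
    (\<forall>i<totient m. \<forall>j<totient m. \<kappa> i = \<kappa> j \<longrightarrow> (\<forall>p\<in>prime_factors m. \<iota> i p = \<iota> j p) \<longrightarrow> i = j) \<and>
    (\<forall>K<m div rad m. \<forall>J. (\<forall>p\<in>prime_factors m. J p < p - 1) \<longrightarrow>
      (\<exists>i<totient m. \<kappa> i = K \<and> (\<forall>p\<in>prime_factors m. \<iota> i p = J p)))"

lemma labellingD:
  assumes "labelling m \<kappa> \<iota>"
  shows "\<And>i. i < totient m \<Longrightarrow> \<kappa> i < m div rad m"
    and "\<And>i p. i < totient m \<Longrightarrow> p \<in> prime_factors m \<Longrightarrow> \<iota> i p < p - 1"
    and "\<And>i j. i < totient m \<Longrightarrow> j < totient m \<Longrightarrow> \<kappa> i = \<kappa> j \<Longrightarrow>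
      (\<And>p. p \<in> prime_factors m \<Longrightarrow> \<iota> i p = \<iota> j p) \<Longrightarrow> i = j"
    and "\<And>K J. K < m div rad m \<Longrightarrow> (\<And>p. p \<in> prime_factors m \<Longrightarrow> J p < p - 1) \<Longrightarrow>
      \<exists>i<totient m. \<kappa> i = K \<and> (\<forall>p\<in>prime_factors m. \<iota> i p = J p)"
  using assms unfolding labelling_def by blast+

text \<open>Block \<open>K\<close> carries the tensor product of the simplex vertices number
  \<open>T p\<close>. The product over the set of primes avoids fixing an order of the
  factors.\<close>

definition root_point ::
  "nat \<Rightarrow> (nat \<Rightarrow> nat) \<Rightarrow> (nat \<Rightarrow> nat \<Rightarrow> nat) \<Rightarrow> nat \<Rightarrow> (nat \<Rightarrow> nat) \<Rightarrow> rvec"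
  where "root_point m \<kappa> \<iota> K T = vec_of (totient m)
    (\<lambda>i. if \<kappa> i = K then \<Prod>p\<in>prime_factors m. simplex_coord p (T p) (\<iota> i p) else 0)"

definition root_points :: "nat \<Rightarrow> (nat \<Rightarrow> nat) \<Rightarrow> (nat \<Rightarrow> nat \<Rightarrow> nat) \<Rightarrow> rvec set"
  where "root_points m \<kappa> \<iota> =
    {root_point m \<kappa> \<iota> K T | K T. K < m div rad m \<and> (\<forall>p\<in>prime_factors m. T p < p)}"

section \<open>Evaluation into the complex numbers\<close>

definition evaluate :: "nat \<Rightarrow> (nat \<Rightarrow> complex) \<Rightarrow> rvec \<Rightarrow> complex"
  where "evaluate n e x = (\<Sum>i<n. of_real (Poly_Mapping.lookup x i) * e i)"

text \<open>Some weights send the points injectively to \<open>m\<close>-th roots of unity. This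
  property passes to Kronecker products and makes every point of \<open>V\<close> extreme in the
  hull.\<close>

definition faithful :: "nat \<Rightarrow> rvec set \<Rightarrow> bool"
  where "faithful m V \<longleftrightarrow>
    (\<exists>e. (\<forall>v\<in>V. evaluate (totient m) e v ^ m = 1) \<and> inj_on (evaluate (totient m) e) V)"

lemma linear_evaluate: "linear (evaluate n e)"
  by (intro linearI)
    (simp_all add: evaluate_def lookup_add lookup_scaleR sum.distrib scaleR_sum_right
      distrib_right scaleR_conv_of_real mult.assoc sum_distrib_left)

lemma extreme_points_faithful:
  assumes "faithful m V" "m > 0"
  shows "{x. x extreme_point_of (convex hull V)} = V"
proof -
  obtain e where e: "\<And>v. v \<in> V \<Longrightarrow> evaluate (totient m) e v ^ m = 1"
    and inj: "inj_on (evaluate (totient m) e) V"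
    using assms(1) by (auto simp: faithful_def)
  have "norm (evaluate (totient m) e v) = 1" if "v \<in> V" for v
  proof -
    have "norm (evaluate (totient m) e v) ^ m = 1" using e[OF that] by (simp flip: norm_power)
    then show ?thesis
      using assms(2) power_eq_imp_eq_base[of "norm (evaluate (totient m) e v)" m 1] by simp
  qed
  then show ?thesis
    using extreme_points_of_convex_hull_unimodular[OF linear_evaluate _ inj] by blast
qed

text \<open>With the weights of the product basis, the double sum factors.\<close>

lemma evaluate_kronecker:
  assumes "Poly_Mapping.keys w \<subseteq> {..<d}"
  shows "evaluate (n * d) (\<lambda>i. e (i div d) * f (i mod d)) (kronecker d v w) =
    evaluate n e v * evaluate d f w"
proof -
  have "evaluate (n * d) (\<lambda>i. e (i div d) * f (i mod d)) (kronecker d v w) =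
     (\<Sum>i<n * d. (of_real (Poly_Mapping.lookup v (i div d)) * e (i div d)) *
       (of_real (Poly_Mapping.lookup w (i mod d)) * f (i mod d)))"
    by (simp add: evaluate_def lookup_kronecker[OF assms] mult_ac)
  also have "\<dots> = (\<Sum>k<n. \<Sum>j<d. (of_real (Poly_Mapping.lookup v k) * e k) *
       (of_real (Poly_Mapping.lookup w j) * f j))"
    by (rule sum_divmod)
  finally show ?thesis by (simp add: evaluate_def sum_product)
qed

text \<open>For coprime \<open>m\<close> and \<open>n\<close>, a product of an \<open>m\<close>-th
  and an \<open>n\<close>-th root of unity determines both factors: the \<open>n\<close>-th power
  removes the second one, and \<open>n\<close> is invertible modulo \<open>m\<close>.\<close>

lemma faithful_kronecker:
  assumes "faithful m V" "faithful n W" "coprime m n" "m > 0" "n > 0"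
    and V: "\<And>v. v \<in> V \<Longrightarrow> Poly_Mapping.keys v \<subseteq> {..<totient m}"
    and W: "\<And>w. w \<in> W \<Longrightarrow> Poly_Mapping.keys w \<subseteq> {..<totient n}"
  shows "faithful (m * n) {kronecker (totient n) v w | v w. v \<in> V \<and> w \<in> W}"
proof -
  obtain e where e: "\<And>v. v \<in> V \<Longrightarrow> evaluate (totient m) e v ^ m = 1"
      "inj_on (evaluate (totient m) e) V"
    using assms(1) by (auto simp: faithful_def)
  obtain f where f: "\<And>w. w \<in> W \<Longrightarrow> evaluate (totient n) f w ^ n = 1"
      "inj_on (evaluate (totient n) f) W"
    using assms(2) by (auto simp: faithful_def)
  define E F where "E = evaluate (totient m) e" and "F = evaluate (totient n) f"
  define G where "G = evaluate (totient (m * n)) (\<lambda>i. e (i div totient n) * f (i mod totient n))"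
  have G: "G (kronecker (totient n) v w) = E v * F w" if "w \<in> W" for v w
    using evaluate_kronecker[OF W[OF that]] assms(3)
    by (simp add: G_def E_def F_def totient_mult_coprime)
  have "v = v' \<and> w = w'" if *: "v \<in> V" "w \<in> W" "v' \<in> V" "w' \<in> W" "E v * F w = E v' * F w'" for v v' w w'
  proof -
    have m: "E v ^ m = 1" "E v' ^ m = 1" and n: "F w ^ n = 1" "F w' ^ n = 1"
      using e(1) f(1) * by (auto simp: E_def F_def)
    have "E v ^ n = E v ^ n * F w ^ n" using n by simp
    also have "\<dots> = E v' ^ n * F w' ^ n" using *(5) by (simp flip: power_mult_distrib)
    also have "\<dots> = E v' ^ n" using n by simp
    finally have En: "E v ^ n = E v' ^ n" .
    \<comment> \<open>\<open>x\<close> inverts \<open>n\<close> modulo \<open>m\<close>, so the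
      power \<open>x\<close> undoes \<open>z ^ n\<close> on \<open>m\<close>-th roots of
      unity.\<close>
    obtain x y where "n * x = m * y + 1"
      using bezout_nat[of n m] assms(3,5) by (auto simp: gcd.commute)
    then have root: "z = (z ^ n) ^ x" if "z ^ m = 1" for z :: complex
      using that by (metis mult.left_neutral power_add power_mult power_one power_one_right)
    have Ev: "E v = E v'"
      using root[OF m(1)] root[OF m(2)] En by simp
    have "E v' \<noteq> 0" using m(2) assms(4) by (auto simp: zero_power)
    then have "F w = F w'" using *(5) Ev by simp
    then show ?thesis
      using Ev e(2) f(2) * by (auto simp: E_def F_def dest: inj_onD)
  qed
  then have "inj_on G {kronecker (totient n) v w | v w. v \<in> V \<and> w \<in> W}"
    by (auto intro!: inj_onI simp: G) blast+
  moreover have "G x ^ (m * n) = 1" if x: "x \<in> {kronecker (totient n) v w | v w. v \<in> V \<and> w \<in> W}" for x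
  proof -
    obtain v w where vw: "x = kronecker (totient n) v w" "v \<in> V" "w \<in> W" using x by blast
    have "G x ^ (m * n) = (E v ^ m) ^ n * (F w ^ n) ^ m"
      using G[OF vw(3)] vw(1) by (simp add: power_mult_distrib mult.commute flip: power_mult)
    then show ?thesis using e(1)[OF vw(2)] f(1)[OF vw(3)] by (simp add: E_def F_def)
  qed
  ultimately show ?thesis unfolding faithful_def G_def by blast
qed

section \<open>The standard form for prime powers, primes and 1\<close>

context prime_power_root
begin

lemma prime_factors_prime_power: "prime_factors (p ^ a) = {p}"
  using p a by (simp add: prime_factors_power prime_prime_factors)

lemma div_rad_prime_power: "p ^ a div rad (p ^ a) = q"
proof -
  have "rad (p ^ a) = p" by (simp add: rad_def prime_factors_prime_power)
  then show ?thesis using p1 by (simp add: pq)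
qed

lemma root_point_prime_power:
  "root_point (p ^ a) (\<lambda>i. i div (p - 1)) (\<lambda>i _. i mod (p - 1)) K T = point K (T p)"
  unfolding root_point_def point_def prime_factors_prime_power tot by (simp cong: if_cong)

lemma root_points_prime_power:
  "root_points (p ^ a) (\<lambda>i. i div (p - 1)) (\<lambda>i _. i mod (p - 1)) = {x. \<exists>n. represents p a x (\<zeta> ^ n)}"
proof -
  \<comment> \<open>Every \<open>t < p\<close> is the value at \<open>p\<close> of a constant
    function \<open>T\<close>.\<close>
  have "(\<exists>T::nat \<Rightarrow> nat. T p < p \<and> x = point K (T p)) \<longleftrightarrow> (\<exists>t<p. x = point K t)" for x K
    by (auto intro: exI[of _ "\<lambda>_. _"])
  then show ?thesis
    unfolding root_points_def represents_root_iff root_point_prime_power prime_factors_prime_power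
      div_rad_prime_power by auto
qed

lemma labelling_prime_power: "labelling (p ^ a) (\<lambda>i. i div (p - 1)) (\<lambda>i _. i mod (p - 1))"
  unfolding labelling_def prime_factors_prime_power div_rad_prime_power tot
proof (intro conjI allI impI)
  fix i assume "i < q * (p - 1)"
  then show "i div (p - 1) < q" by (rule less_mult_imp_div_less)
  show "\<forall>r\<in>{p}. i mod (p - 1) < r - 1" using p1 by simp
next
  fix i j assume "i div (p - 1) = j div (p - 1)" "\<forall>r\<in>{p}. i mod (p - 1) = j mod (p - 1)"
  then show "i = j" by (metis div_mult_mod_eq singletonI)
next
  fix K J assume K: "K < q" and J: "\<forall>r\<in>{p}. J r < r - 1"
  have "K * (p - 1) + J p < q * (p - 1)" using K J by (intro mixed_radix_less) auto
  then show "\<exists>i<q * (p - 1). i div (p - 1) = K \<and> (\<forall>r\<in>{p}. i mod (p - 1) = J r)"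
    using J by (intro exI[of _ "K * (p - 1) + J p"]) auto
qed

text \<open>With the basis elements as weights, evaluation returns the represented root, and
  injectivity is \<open>represents_unique\<close>.\<close>

lemma faithful_prime_power: "faithful (p ^ a) {x. \<exists>n. represents p a x (\<zeta> ^ n)}"
proof -
  have ev: "evaluate (totient (p ^ a)) weight x = z" if "represents p a x z" for x z
    using that by (simp add: evaluate_def tot represents_iff)
  have "(\<zeta> ^ n) ^ (p ^ a) = 1" for n
    using root_power by (metis mult.commute power_mult power_one pq)
  moreover have "inj_on (evaluate (totient (p ^ a)) weight) {x. \<exists>n. represents p a x (\<zeta> ^ n)}"
    by (auto intro!: inj_onI simp: ev dest: represents_unique)
  ultimately show ?thesis
    unfolding faithful_def by (auto simp: ev intro!: exI[of _ weight])
qed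

end

text \<open>The existential labelling hides the order of the coordinates, which varies with the
  factorisation. \<open>faithful\<close> is carried along because \<open>polytope_tensor\<close>
  refers to extreme points, which must be identified at each product.\<close>

definition standard_form :: "nat \<Rightarrow> rvec set \<Rightarrow> bool"
  where "standard_form m P \<longleftrightarrow> (\<exists>\<kappa> \<iota>. labelling m \<kappa> \<iota> \<and> faithful m (root_points m \<kappa> \<iota>) \<and>
    P = convex hull (root_points m \<kappa> \<iota>))"

lemma standard_form_prime_power:
  assumes "prime p" "a > 0"
  shows "standard_form (p ^ a)
    (convex hull {x. \<exists>n. represents p a x (exp (2 * of_real pi * \<i> / of_nat (p ^ a)) ^ n)})"
proof -
  interpret prime_power_root p a "p ^ (a - 1)" "exp (2 * of_real pi * \<i> / of_nat (p ^ a))"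
    using assms by unfold_locales auto
  show ?thesis
    unfolding standard_form_def
    using labelling_prime_power faithful_prime_power root_points_prime_power by metis
qed

text \<open>The prime power construction with \<open>a = 1\<close> has a single block, and its
  points are the listed vertices of the simplex.\<close>

lemma standard_form_prime:
  assumes p: "prime p"
  shows "standard_form p (convex hull (insert (- (\<Sum>i<p - 1. unit_vec i)) (unit_vec ` {..<p - 1})))"
proof -
  interpret prime_power_root p 1 1 "exp (2 * of_real pi * \<i> / of_nat (p ^ 1))"
    using p by unfold_locales auto
  have last: "point 0 (p - 1) = - (\<Sum>i<p - 1. unit_vec i)"
    unfolding point_def by (rule poly_mapping_eqI)
      (auto simp: simplex_coord_def lookup_sum lookup_single when_def)
  have unit: "point 0 t = unit_vec t" if "t < p - 1" for t
    unfolding point_def by (rule poly_mapping_eqI)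
      (use that in \<open>auto simp: simplex_coord_def lookup_single when_def\<close>)
  have "{x. \<exists>n. represents p 1 x (exp (2 * of_real pi * \<i> / of_nat (p ^ 1)) ^ n)} = point 0 ` {..<p}"
    unfolding represents_root_iff by auto
  also have "{..<p} = insert (p - 1) {..<p - 1}" using p1 by auto
  also have "point 0 ` \<dots> = insert (- (\<Sum>i<p - 1. unit_vec i)) (unit_vec ` {..<p - 1})"
    using image_cong[OF refl, of "{..<p - 1}" "point 0" unit_vec] unit
    by (simp only: image_insert last lessThan_iff)
  finally show ?thesis
    using standard_form_prime_power[OF p, of 1] by simp
qed

lemma standard_form_one: "standard_form 1 {unit_vec 0}"
proof -
  have "root_point 1 (\<lambda>_. 0) (\<lambda>_ _. 0) 0 T = unit_vec 0" for T
    by (rule poly_mapping_eqI) (auto simp: root_point_def lookup_one when_def)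
  then have "root_points 1 (\<lambda>_. 0) (\<lambda>_ _. 0) = {unit_vec 0}"
    by (auto simp: root_points_def rad_def)
  moreover have "labelling 1 (\<lambda>_. 0) (\<lambda>_ _. 0)"
    by (auto simp: labelling_def rad_def)
  moreover have "faithful 1 {unit_vec 0}"
    by (auto simp: faithful_def evaluate_def intro!: exI[of _ "\<lambda>_. 1"])
  ultimately show ?thesis
    unfolding standard_form_def by (metis convex_hull_singleton)
qed

lemma keys_root_point: "Poly_Mapping.keys (root_point m \<kappa> \<iota> K T) \<subseteq> {..<totient m}"
  unfolding root_point_def by (rule keys_vec_of)

section \<open>Products of coprime orders\<close>

locale coprime_labellings =
  fixes m n \<kappa>1 \<kappa>2 \<iota>1 \<iota>2
  assumes m: "m > 0" and n: "n > 0" and cop: "coprime m n"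
    and lab1: "labelling m \<kappa>1 \<iota>1" and lab2: "labelling n \<kappa>2 \<iota>2"
begin

text \<open>Block numbers combine in mixed radix like the Kronecker indices, the base being the
  number of blocks for \<open>n\<close>.\<close>

definition \<kappa> :: "nat \<Rightarrow> nat"
  where "\<kappa> i = \<kappa>1 (i div totient n) * (n div rad n) + \<kappa>2 (i mod totient n)"

definition \<iota> :: "nat \<Rightarrow> nat \<Rightarrow> nat"
  where "\<iota> i p = (if p \<in> prime_factors m then \<iota>1 (i div totient n) p else \<iota>2 (i mod totient n) p)"

lemma tot: "totient (m * n) = totient m * totient n" and tn: "totient n > 0"
  using cop n by (auto simp: totient_mult_coprime)

lemma div_rad: "m * n div rad (m * n) = (m div rad m) * (n div rad n)" and drn: "n div rad n > 0"
  using rad_dvd[OF m] rad_dvd[OF n] m n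
  by (auto simp: rad_mult[OF m n cop] div_mult_div_if_dvd rad_pos div_greater_zero_iff dvd_imp_le)

lemma primes: "prime_factors (m * n) = prime_factors m \<union> prime_factors n"
    "prime_factors m \<inter> prime_factors n = {}"
  using m n cop by (auto simp: prime_factors_product in_prime_factors_iff)
    (metis coprime_common_divisor not_prime_unit)

lemma divmod: "i < totient (m * n) \<Longrightarrow> i div totient n < totient m \<and> i mod totient n < totient n"
  using tn by (simp add: tot less_mult_imp_div_less)

lemma \<kappa>_eq:
  assumes "i < totient (m * n)" "K2 < n div rad n"
  shows "\<kappa> i = K1 * (n div rad n) + K2 \<longleftrightarrow> \<kappa>1 (i div totient n) = K1 \<and> \<kappa>2 (i mod totient n) = K2"
proof -
  let ?M = "n div rad n" and ?k = "\<kappa>1 (i div totient n)" and ?l = "\<kappa>2 (i mod totient n)"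
  have l: "?l < ?M" using labellingD(1)[OF lab2] divmod[OF assms(1)] by blast
  show ?thesis
  proof
    assume "\<kappa> i = K1 * ?M + K2"
    then have *: "?k * ?M + ?l = K1 * ?M + K2" by (simp add: \<kappa>_def)
    have "?k = K1" using arg_cong[OF *, of "\<lambda>x. x div ?M"] l assms(2) by simp
    then show "?k = K1 \<and> ?l = K2" using * by simp
  qed (auto simp: \<kappa>_def)
qed

text \<open>The two block conditions merge by \<open>\<kappa>_eq\<close>, and the two products over
  primes merge because \<open>m\<close> and \<open>n\<close> have no prime in common.\<close>

lemma kronecker_root_point:
  assumes "K2 < n div rad n"
  shows "kronecker (totient n) (root_point m \<kappa>1 \<iota>1 K1 T1) (root_point n \<kappa>2 \<iota>2 K2 T2) =
    root_point (m * n) \<kappa> \<iota> (K1 * (n div rad n) + K2) (\<lambda>p. if p \<in> prime_factors m then T1 p else T2 p)"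
  unfolding root_point_def kronecker_vec_of tot[symmetric]
proof (rule vec_of_cong)
  fix i assume i: "i < totient (m * n)"
  let ?T = "\<lambda>p. if p \<in> prime_factors m then T1 p else T2 p"
  have "(\<Prod>p\<in>prime_factors (m * n). simplex_coord p (?T p) (\<iota> i p)) =
      (\<Prod>p\<in>prime_factors m. simplex_coord p (?T p) (\<iota> i p)) *
      (\<Prod>p\<in>prime_factors n. simplex_coord p (?T p) (\<iota> i p))"
    using primes by (simp add: prod.union_disjoint)
  also have "(\<Prod>p\<in>prime_factors m. simplex_coord p (?T p) (\<iota> i p)) =
      (\<Prod>p\<in>prime_factors m. simplex_coord p (T1 p) (\<iota>1 (i div totient n) p))"
    by (intro prod.cong) (simp_all add: \<iota>_def)
  also have "(\<Prod>p\<in>prime_factors n. simplex_coord p (?T p) (\<iota> i p)) =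
      (\<Prod>p\<in>prime_factors n. simplex_coord p (T2 p) (\<iota>2 (i mod totient n) p))"
    using primes by (intro prod.cong) (auto simp: \<iota>_def)
  finally show "(if \<kappa>1 (i div totient n) = K1
          then \<Prod>p\<in>prime_factors m. simplex_coord p (T1 p) (\<iota>1 (i div totient n) p) else 0) *
         (if \<kappa>2 (i mod totient n) = K2
          then \<Prod>p\<in>prime_factors n. simplex_coord p (T2 p) (\<iota>2 (i mod totient n) p) else 0) =
         (if \<kappa> i = K1 * (n div rad n) + K2
          then \<Prod>p\<in>prime_factors (m * n). simplex_coord p (?T p) (\<iota> i p) else 0)"
    using \<kappa>_eq[OF i assms, of K1] by simp
qed

lemma root_points_mult:
  "root_points (m * n) \<kappa> \<iota> =
    {kronecker (totient n) v w | v w. v \<in> root_points m \<kappa>1 \<iota>1 \<and> w \<in> root_points n \<kappa>2 \<iota>2}"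
proof (intro equalityI subsetI)
  fix x assume "x \<in> root_points (m * n) \<kappa> \<iota>"
  then obtain K T where x: "x = root_point (m * n) \<kappa> \<iota> K T"
    and K: "K < (m div rad m) * (n div rad n)" and T: "\<And>p. p \<in> prime_factors (m * n) \<Longrightarrow> T p < p"
    unfolding root_points_def div_rad by blast
  define K1 K2 where "K1 = K div (n div rad n)" and "K2 = K mod (n div rad n)"
  have K12: "K1 < m div rad m" "K2 < n div rad n"
    using K drn by (simp_all add: K1_def K2_def less_mult_imp_div_less)
  have "K = K1 * (n div rad n) + K2" unfolding K1_def K2_def by (simp only: div_mult_mod_eq)
  \<comment> \<open>The same \<open>T\<close> serves both factors, as the combined choice is then
    \<open>T\<close> again.\<close>
  then have "x = kronecker (totient n) (root_point m \<kappa>1 \<iota>1 K1 T) (root_point n \<kappa>2 \<iota>2 K2 T)"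
    using kronecker_root_point[OF K12(2), of K1 T T] x by simp
  moreover have "root_point m \<kappa>1 \<iota>1 K1 T \<in> root_points m \<kappa>1 \<iota>1"
    "root_point n \<kappa>2 \<iota>2 K2 T \<in> root_points n \<kappa>2 \<iota>2"
    using K12 T primes(1) unfolding root_points_def by blast+
  ultimately show "x \<in> {kronecker (totient n) v w | v w. v \<in> root_points m \<kappa>1 \<iota>1 \<and> w \<in> root_points n \<kappa>2 \<iota>2}"
    by blast
next
  fix x assume "x \<in> {kronecker (totient n) v w | v w. v \<in> root_points m \<kappa>1 \<iota>1 \<and> w \<in> root_points n \<kappa>2 \<iota>2}"
  then obtain K1 T1 K2 T2 where
    x: "x = kronecker (totient n) (root_point m \<kappa>1 \<iota>1 K1 T1) (root_point n \<kappa>2 \<iota>2 K2 T2)"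
    and K: "K1 < m div rad m" "K2 < n div rad n"
    and T: "\<And>p. p \<in> prime_factors m \<Longrightarrow> T1 p < p" "\<And>p. p \<in> prime_factors n \<Longrightarrow> T2 p < p"
    unfolding root_points_def by blast
  define T where "T p = (if p \<in> prime_factors m then T1 p else T2 p)" for p
  have "x = root_point (m * n) \<kappa> \<iota> (K1 * (n div rad n) + K2) T"
    unfolding x kronecker_root_point[OF K(2)] T_def ..
  moreover have "K1 * (n div rad n) + K2 < (m div rad m) * (n div rad n)"
    using K by (rule mixed_radix_less)
  moreover have "\<forall>p\<in>prime_factors (m * n). T p < p"
    using T primes(1) by (auto simp: T_def)
  ultimately show "x \<in> root_points (m * n) \<kappa> \<iota>"
    unfolding root_points_def div_rad by blast
qed

lemma labelling_mult: "labelling (m * n) \<kappa> \<iota>"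
  unfolding labelling_def div_rad
proof (intro conjI allI impI ballI)
  fix i assume i: "i < totient (m * n)"
  note dm = divmod[OF i]
  show "\<kappa> i < (m div rad m) * (n div rad n)"
    unfolding \<kappa>_def using dm labellingD(1)[OF lab1] labellingD(1)[OF lab2]
    by (intro mixed_radix_less) blast+
  fix p assume "p \<in> prime_factors (m * n)"
  then show "\<iota> i p < p - 1"
    using dm primes(1) labellingD(2)[OF lab1, of _ p] labellingD(2)[OF lab2, of _ p] by (auto simp: \<iota>_def)
next
  fix i j assume i: "i < totient (m * n)" and j: "j < totient (m * n)"
    and \<kappa>: "\<kappa> i = \<kappa> j" and \<iota>: "\<forall>p\<in>prime_factors (m * n). \<iota> i p = \<iota> j p"
  note dm = divmod[OF i] divmod[OF j]
  have "\<kappa>2 (j mod totient n) < n div rad n" using dm labellingD(1)[OF lab2] by blast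
  then have k: "\<kappa>1 (i div totient n) = \<kappa>1 (j div totient n) \<and> \<kappa>2 (i mod totient n) = \<kappa>2 (j mod totient n)"
    using \<kappa>_eq[OF i] \<kappa> \<kappa>_def[of j] by metis
  have "i div totient n = j div totient n"
  proof (rule labellingD(3)[OF lab1])
    fix p assume "p \<in> prime_factors m"
    moreover from this have "\<iota> i p = \<iota> j p" using \<iota> primes(1) by blast
    ultimately show "\<iota>1 (i div totient n) p = \<iota>1 (j div totient n) p" by (simp add: \<iota>_def)
  qed (use dm k in auto)
  moreover have "i mod totient n = j mod totient n"
  proof (rule labellingD(3)[OF lab2])
    fix p assume "p \<in> prime_factors n"
    then have "p \<in> prime_factors (m * n)" "p \<notin> prime_factors m" using primes by auto
    then show "\<iota>2 (i mod totient n) p = \<iota>2 (j mod totient n) p" using \<iota> by (auto simp: \<iota>_def)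
  qed (use dm k in auto)
  ultimately show "i = j" by (metis div_mult_mod_eq)
next
  fix K J assume K: "K < (m div rad m) * (n div rad n)" and J: "\<forall>p\<in>prime_factors (m * n). J p < p - 1"
  define K1 K2 where "K1 = K div (n div rad n)" and "K2 = K mod (n div rad n)"
  have K12: "K1 < m div rad m" "K2 < n div rad n"
    using K drn by (simp_all add: K1_def K2_def less_mult_imp_div_less)
  obtain i1 where i1: "i1 < totient m" "\<kappa>1 i1 = K1" "\<And>p. p \<in> prime_factors m \<Longrightarrow> \<iota>1 i1 p = J p"
    using labellingD(4)[OF lab1 K12(1), of J] J primes(1) by blast
  obtain i2 where i2: "i2 < totient n" "\<kappa>2 i2 = K2" "\<And>p. p \<in> prime_factors n \<Longrightarrow> \<iota>2 i2 p = J p"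
    using labellingD(4)[OF lab2 K12(2), of J] J primes(1) by blast
  define i where "i = i1 * totient n + i2"
  have dm: "i div totient n = i1" "i mod totient n = i2" using i2(1) tn by (auto simp: i_def)
  have "i < totient (m * n)" unfolding i_def tot using i1(1) i2(1) by (rule mixed_radix_less)
  moreover have "\<kappa> i = K"
    unfolding \<kappa>_def dm i1 i2 K1_def K2_def by (rule div_mult_mod_eq)
  moreover have "\<forall>p\<in>prime_factors (m * n). \<iota> i p = J p"
    using i1(3) i2(3) primes(1) by (auto simp: \<iota>_def dm)
  ultimately show "\<exists>i<totient (m * n). \<kappa> i = K \<and> (\<forall>p\<in>prime_factors (m * n). \<iota> i p = J p)" by blast
qed

end

text \<open>Faithfulness identifies the extreme points of both factors with their root points, so
  the tensor product is the hull of the Kronecker products of root points.\<close>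

lemma standard_form_mult:
  assumes m: "m > 0" and n: "n > 0" and cop: "coprime m n"
    and P: "standard_form m P" and Q: "standard_form n Q"
  shows "standard_form (m * n) (polytope_tensor (totient n) P Q)"
proof -
  obtain \<kappa>1 \<iota>1 where 1: "labelling m \<kappa>1 \<iota>1" "faithful m (root_points m \<kappa>1 \<iota>1)"
    "P = convex hull (root_points m \<kappa>1 \<iota>1)"
    using P by (auto simp: standard_form_def)
  obtain \<kappa>2 \<iota>2 where 2: "labelling n \<kappa>2 \<iota>2" "faithful n (root_points n \<kappa>2 \<iota>2)"
    "Q = convex hull (root_points n \<kappa>2 \<iota>2)"
    using Q by (auto simp: standard_form_def)
  interpret coprime_labellings m n \<kappa>1 \<kappa>2 \<iota>1 \<iota>2
    using m n cop 1(1) 2(1) by unfold_locales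
  have "v extreme_point_of P \<longleftrightarrow> v \<in> root_points m \<kappa>1 \<iota>1" for v
    using extreme_points_faithful[OF 1(2) m] 1(3) by blast
  moreover have "w extreme_point_of Q \<longleftrightarrow> w \<in> root_points n \<kappa>2 \<iota>2" for w
    using extreme_points_faithful[OF 2(2) n] 2(3) by blast
  ultimately have "polytope_tensor (totient n) P Q = convex hull (root_points (m * n) \<kappa> \<iota>)"
    by (simp add: polytope_tensor_def root_points_mult)
  moreover have "faithful (m * n) (root_points (m * n) \<kappa> \<iota>)"
    unfolding root_points_mult
    by (intro faithful_kronecker 1 2 cop m n) (use keys_root_point in \<open>fastforce simp: root_points_def\<close>)+
  ultimately show ?thesis
    unfolding standard_form_def using labelling_mult by blast
qed

lemma cyclotomic_polytope_standard_form: "cyclotomic_polytope m P \<Longrightarrow> standard_form m P"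
proof (induction rule: cyclotomic_polytope.induct)
  case one
  show ?case by (rule standard_form_one)
next
  case (prime p)
  then show ?case by (rule standard_form_prime)
next
  case (prime_power p a)
  then show ?case using standard_form_prime_power[of p a] by simp
next
  case (product m1 m2 P Q)
  then show ?case by (intro standard_form_mult) auto
qed

section \<open>Comparison of \<open>m\<close> with \<open>rad m\<close>\<close>

text \<open>The order \<open>rad m\<close> has a single block, so its coordinates are labelled by
  residues alone. Coordinate \<open>i\<close> of order \<open>m\<close> is matched with the
  coordinate of the same residues in copy number \<open>\<kappa> i\<close>.\<close>

lemma root_points_permute:
  assumes m: "m > 0" and lab: "labelling m \<kappa> \<iota>" and lab': "labelling (rad m) \<kappa>' \<iota>'"
  shows "\<exists>\<sigma>. \<sigma> permutes {..<totient m} \<and>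
    root_points m \<kappa> \<iota> =
      permute_coords \<sigma> ` (\<Union>K<m div rad m. shift_vec (K * totient (rad m)) ` root_points (rad m) \<kappa>' \<iota>')"
proof -
  define d M where "d = totient (rad m)" and "M = m div rad m"
  have tot: "totient m = M * d" using totient_rad[OF m] by (simp add: d_def M_def)
  have one: "rad m div rad (rad m) = 1" using rad_pos[of m] by simp
  have "\<exists>r<d. \<forall>p\<in>prime_factors m. \<iota>' r p = \<iota> i p" if "i < totient m" for i
  proof -
    have "\<exists>r<totient (rad m). \<kappa>' r = 0 \<and> (\<forall>p\<in>prime_factors (rad m). \<iota>' r p = \<iota> i p)"
      by (rule labellingD(4)[OF lab'])
        (simp_all only: one prime_factors_rad labellingD(2)[OF lab that] zero_less_one)
    then show ?thesis unfolding prime_factors_rad d_def by blast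
  qed
  then obtain \<rho> where \<rho>: "\<And>i. i < totient m \<Longrightarrow> \<rho> i < d"
    "\<And>i p. i < totient m \<Longrightarrow> p \<in> prime_factors m \<Longrightarrow> \<iota>' (\<rho> i) p = \<iota> i p"
    by metis
  \<comment> \<open>The identity beyond \<open>totient m\<close> makes \<sigma> a permutation of all
    natural numbers, as \<open>map_key\<close> requires injectivity everywhere.\<close>
  define \<sigma> where "\<sigma> i = (if i < totient m then \<kappa> i * d + \<rho> i else i)" for i
  have \<kappa>M: "\<kappa> i < M" if "i < totient m" for i
    using labellingD(1)[OF lab that] by (simp add: M_def)
  have "inj_on \<sigma> {..<totient m}"
  proof (rule inj_onI)
    fix i j assume "i \<in> {..<totient m}" "j \<in> {..<totient m}" and eq: "\<sigma> i = \<sigma> j"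
    then have ij: "i < totient m" "j < totient m" by auto
    have *: "\<kappa> i * d + \<rho> i = \<kappa> j * d + \<rho> j" using eq ij by (simp add: \<sigma>_def)
    have "\<kappa> i = \<kappa> j" using arg_cong[OF *, of "\<lambda>x. x div d"] \<rho>(1)[OF ij(1)] \<rho>(1)[OF ij(2)] by simp
    moreover have "\<rho> i = \<rho> j" using * calculation by simp
    ultimately show "i = j"
      using labellingD(3)[OF lab ij] \<rho>(2)[OF ij(1)] \<rho>(2)[OF ij(2)] by metis
  qed
  moreover have "\<sigma> ` {..<totient m} \<subseteq> {..<totient m}"
    using \<kappa>M \<rho>(1) mixed_radix_less by (auto simp: \<sigma>_def tot)
  ultimately have "bij_betw \<sigma> {..<totient m} {..<totient m}"
    by (simp only: bij_betw_def endo_inj_surj finite_lessThan)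
  then have perm: "\<sigma> permutes {..<totient m}"
    by (rule bij_imp_permutes) (simp add: \<sigma>_def)
  have key: "permute_coords \<sigma> (shift_vec (K * d) (root_point (rad m) \<kappa>' \<iota>' 0 T)) = root_point m \<kappa> \<iota> K T"
    if K: "K < M" for K T
  proof (rule poly_mapping_eqI)
    fix i
    have \<kappa>': "\<kappa>' r = 0" if "r < d" for r
      using labellingD(1)[OF lab', of r] that one by (simp add: d_def)
    have L: "Poly_Mapping.lookup (shift_vec (K * d) (root_point (rad m) \<kappa>' \<iota>' 0 T)) j =
        (if K * d \<le> j \<and> j - K * d < d
          then \<Prod>p\<in>prime_factors m. simplex_coord p (T p) (\<iota>' (j - K * d) p) else 0)" for j
      using \<kappa>' by (auto simp: lookup_shift_vec root_point_def prime_factors_rad simp flip: d_def)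
    have R: "Poly_Mapping.lookup (root_point m \<kappa> \<iota> K T) i = (if i < totient m \<and> \<kappa> i = K
        then \<Prod>p\<in>prime_factors m. simplex_coord p (T p) (\<iota> i p) else 0)"
      by (simp add: root_point_def)
    show "Poly_Mapping.lookup (permute_coords \<sigma> (shift_vec (K * d) (root_point (rad m) \<kappa>' \<iota>' 0 T))) i =
        Poly_Mapping.lookup (root_point m \<kappa> \<iota> K T) i"
    proof (cases "i < totient m")
      case False
      \<comment> \<open>Copy \<open>K\<close> ends at or before \<open>totient m\<close>, so the
        shifted point vanishes at \<open>i\<close> as well.\<close>
      have "K * d + d \<le> M * d" using K by (metis Suc_leI add.commute mult_Suc mult_le_mono1)
      then show ?thesis
        using False tot
        by (simp add: lookup_permute_coords[OF permutes_inj[OF perm]] L R \<sigma>_def)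
    next
      case True
      have "K * d \<le> \<kappa> i * d + \<rho> i \<and> \<kappa> i * d + \<rho> i - K * d < d \<longleftrightarrow> \<kappa> i = K"
      proof
        define r where "r = \<kappa> i * d + \<rho> i - K * d"
        assume "K * d \<le> \<kappa> i * d + \<rho> i \<and> \<kappa> i * d + \<rho> i - K * d < d"
        then have eq: "\<kappa> i * d + \<rho> i = K * d + r" and r: "r < d" by (simp_all add: r_def)
        show "\<kappa> i = K"
          using arg_cong[OF eq, of "\<lambda>x. x div d"] r \<rho>(1)[OF True] by simp
      qed (use \<rho>(1)[OF True] in auto)
      then show ?thesis
        using True \<rho>(2)[OF True]
        by (auto simp: lookup_permute_coords[OF permutes_inj[OF perm]] L R \<sigma>_def)
    qed
  qed
  have "root_points (rad m) \<kappa>' \<iota>' = {root_point (rad m) \<kappa>' \<iota>' 0 T | T. \<forall>p\<in>prime_factors m. T p < p}"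
    unfolding root_points_def one prime_factors_rad by auto
  then have "permute_coords \<sigma> ` (\<Union>K<M. shift_vec (K * d) ` root_points (rad m) \<kappa>' \<iota>') =
      (\<Union>K<M. {permute_coords \<sigma> (shift_vec (K * d) (root_point (rad m) \<kappa>' \<iota>' 0 T)) | T.
        \<forall>p\<in>prime_factors m. T p < p})"
    by (simp add: image_UN image_image) blast
  also have "\<dots> = root_points m \<kappa> \<iota>"
    using key unfolding root_points_def M_def[symmetric] by auto
  finally show ?thesis using perm unfolding d_def M_def by metis
qed

theorem theorem2p5:
  fixes m :: nat and P Q :: "rvec set"
  assumes "m > 0"
    and "cyclotomic_polytope m P"
    and "cyclotomic_polytope (rad m) Q"
  shows "\<exists>\<sigma>. \<sigma> permutes {..<totient m} \<and>
           P = permute_coords \<sigma> ` direct_sum_power (totient (rad m)) Q (m div rad m)"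
proof -
  obtain \<kappa> \<iota> where lab: "labelling m \<kappa> \<iota>" and P: "P = convex hull (root_points m \<kappa> \<iota>)"
    using cyclotomic_polytope_standard_form[OF assms(2)] by (auto simp: standard_form_def)
  obtain \<kappa>' \<iota>' where lab': "labelling (rad m) \<kappa>' \<iota>'" and Q: "Q = convex hull (root_points (rad m) \<kappa>' \<iota>')"
    using cyclotomic_polytope_standard_form[OF assms(3)] by (auto simp: standard_form_def)
  obtain \<sigma> where \<sigma>: "\<sigma> permutes {..<totient m}" "root_points m \<kappa> \<iota> =
      permute_coords \<sigma> ` (\<Union>K<m div rad m. shift_vec (K * totient (rad m)) ` root_points (rad m) \<kappa>' \<iota>')"
    using root_points_permute[OF assms(1) lab lab'] by blast
  \<comment> \<open>This excludes the empty direct sum, which is \<open>{0}\<close> by convention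
    and not the hull of an empty union.\<close>
  have "m div rad m > 0"
    using rad_dvd[OF assms(1)] assms(1) rad_pos[of m] by (simp add: div_greater_zero_iff dvd_imp_le)
  then have "P = permute_coords \<sigma> ` direct_sum_power (totient (rad m)) Q (m div rad m)"
    unfolding P Q \<sigma>(2)
    by (simp add: direct_sum_power_convex_hull
      convex_hull_linear_image[OF linear_permute_coords[OF permutes_inj[OF \<sigma>(1)]]])
  with \<sigma>(1) show ?thesis by blast
qed

end
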